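(* Let $r \ge 2$, and set $\delta = 2^{-160} r^{-12}$. Then $$R_r(k) \le e^{-\delta k} r^{rk}$$ for every $k \in \mathbb{N}$ with $k \ge 2^{160} r^{16}$.
   Context: For $r,k \in \mathbb{N}$, $R_r(k)$ is the minimum $n \in \mathbb{N}$ such that every colouring of the edges of the complete graph $K_n$ with $r$ colours contains a monochromatic copy of $K_k$. *)

theory Defs
  imports Complex_Main "HOL-Library.Ramsey"
begin

text \<open>The edge set of the complete graph on \<open>{..<n}\<close> is \<open>[{..<n}]\<^bsup>2\<^esup>\<close>, so
  \<open>partn {..<n} k 2 {..<r}\<close> says that every colouring of its edges with
  colours \<open>0, \<dots>, r - 1\<close> has a monochromatic clique on \<open>k\<close> vertices.\<close>

definition ramsey_number :: "nat \<Rightarrow> nat \<Rightarrow> nat"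
  where "ramsey_number r k = (LEAST n. partn {..<n} k 2 {..<r})"

text \<open>The minimum is always attained, i.e. \<open>LEAST\<close> is never applied to an unsatisfiable predicate.\<close>

lemma partn_ramsey_number: "partn {..<ramsey_number r k} k 2 {..<r}"
proof -
  obtain N :: nat where "partn_lst {..<N} (replicate r k) 2"
    using ramsey_full by blast
  then have "partn {..<N} k 2 {..<r}"
    by (auto simp: partn_lst_def partn_def cong: conj_cong)
  then show ?thesis
    unfolding ramsey_number_def by (rule LeastI)
qed

end

theory Submission
  imports Defs
begin

text \<open>
  Let the vectors \<open>\<sigma>\<^sub>i(x)\<close> encode the neighbourhood of \<open>x\<close> in colour \<open>i\<close> inside a set \<open>Y\<^sub>i\<close>, centred
  and normalised. The power series \<open>\<Sum>n. x ^ n / fact (2 * n)\<close> of \<open>cosh (sqrt x)\<close> has nonnegative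
  coefficients and is bounded on the negative axis, so by Schur's product theorem a suitable
  combination of it shows that for random \<open>x\<close>, \<open>y\<close> all inner products \<open>\<langle>\<sigma>\<^sub>i(x), \<sigma>\<^sub>i(y)\<rangle>\<close> are bounded
  below, and one of them is at least \<open>s\<^sup>2\<close>, with probability at least \<open>exp (- O(r (s + 1)))\<close> for
  some \<open>s\<close>. Fixing \<open>x\<close> and passing to \<open>Y\<^sub>i \<inter> N\<^sub>i(x)\<close> thus either loses little density in all colours
  (then \<open>x\<close> is added to the book of its most popular colour) or substantially boosts the density in
  one colour, which cannot happen often. The result is a monochromatic book with a spine of \<open>t\<close>
  vertices, \<open>t\<close> linear in \<open>k\<close>, whose pages number about \<open>r ^ (- t)\<close> times the number of vertices.
  A weighted Erdos-Szekeres bound inside the pages gains a factor \<open>exp (t\<^sup>2 / (32 * k))\<close>, because the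
  remaining problem is off the diagonal. Colourings with a vertex of too large degree in some colour
  are first replaced by a neighbourhood, where the Erdos-Szekeres recursion is already winning.
\<close>

section \<open>Positive semidefinite kernels\<close>

definition cosh_sqrt :: "real \<Rightarrow> real"
  where "cosh_sqrt x = (\<Sum>n. x ^ n / fact (2 * n))"

lemma sums_cosh_sqrt_nonneg:
  assumes "0 \<le> x"
  shows "(\<lambda>n. x ^ n / fact (2 * n)) sums cosh (sqrt x)"
proof -
  have "(\<lambda>n. if even n then sqrt x ^ n /\<^sub>R fact n else 0) sums cosh (sqrt x)"
    by (rule cosh_converges)
  then have "(\<lambda>n. (\<lambda>n. if even n then sqrt x ^ n /\<^sub>R fact n else 0) (2 * n)) sums cosh (sqrt x)"
    by (subst sums_mono_reindex) (auto simp: strict_mono_def elim!: evenE)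
  then show ?thesis
    using assms by (simp only: power_mult real_sqrt_pow2) (simp add: divide_inverse mult.commute)
qed

lemma sums_cosh_sqrt_nonpos:
  assumes "x \<le> 0"
  shows "(\<lambda>n. x ^ n / fact (2 * n)) sums cos (sqrt (- x))"
proof -
  have "(- 1) ^ n / fact (2 * n) * sqrt (- x) ^ (2 * n) = x ^ n / fact (2 * n)" for n
    using assms by (simp add: power_mult power_mult_distrib[symmetric] flip: power_minus)
  then show ?thesis
    using cos_paired[of "sqrt (- x)"] by simp
qed

lemma sums_cosh_sqrt: "(\<lambda>n. x ^ n / fact (2 * n)) sums cosh_sqrt x"
  unfolding cosh_sqrt_def
  using sums_cosh_sqrt_nonneg[of x] sums_cosh_sqrt_nonpos[of x] sums_summable summable_sums
  by (metis linear)

lemma cosh_sqrt_nonneg: "0 \<le> x \<Longrightarrow> cosh_sqrt x = cosh (sqrt x)"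
  using sums_cosh_sqrt sums_cosh_sqrt_nonneg sums_unique2 by blast

lemma cosh_sqrt_nonpos: "x \<le> 0 \<Longrightarrow> cosh_sqrt x = cos (sqrt (- x))"
  using sums_cosh_sqrt sums_cosh_sqrt_nonpos sums_unique2 by blast

lemma cosh_sqrt_ge_m1: "- 1 \<le> cosh_sqrt x"
proof (cases "0 \<le> x")
  case True
  then show ?thesis
    using cosh_real_ge_1[of "sqrt x"] by (simp add: cosh_sqrt_nonneg)
qed (simp add: cosh_sqrt_nonpos)

lemma cosh_sqrt_le_exp: "cosh_sqrt x \<le> exp (sqrt (max 0 x))"
proof (cases "0 \<le> x")
  case True
  then have "exp (- sqrt x) \<le> exp (sqrt x)"
    by simp
  then have "cosh (sqrt x) \<le> exp (sqrt x)"
    unfolding cosh_field_def by (simp add: field_simps)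
  then show ?thesis
    using True by (simp add: cosh_sqrt_nonneg max_def)
next
  case False
  then show ?thesis
    by (simp add: cosh_sqrt_nonpos max_def)
qed

text \<open>For x >= 0 the first three terms of the series suffice. The constant 2 also lifts the
  function to at least 1 everywhere, so that \<open>damp\<close> is both bounded away from 0 and an
  upper bound for x.\<close>

lemma le_2_plus_cosh_sqrt: "x \<le> 2 + cosh_sqrt x"
proof (cases "0 \<le> x")
  case True
  have "(\<Sum>n<3. x ^ n / fact (2 * n)) \<le> (\<Sum>n. x ^ n / fact (2 * n))"
    using True sums_cosh_sqrt sums_summable by (intro sum_le_suminf) auto
  then have *: "1 + x / 2 + x\<^sup>2 / 24 \<le> cosh_sqrt x"
    by (simp add: cosh_sqrt_def numeral_3_eq_3 fact_numeral eval_nat_numeral)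
  \<comment> \<open>This is \<open>2 + (1 + x / 2 + x^2 / 24) - x\<close> with the square
    completed.\<close>
  have "0 \<le> (x - 6)\<^sup>2 / 24 + 3 / 2" by simp
  also have "\<dots> = 3 - x / 2 + x\<^sup>2 / 24" by (simp add: power2_eq_square field_simps)
  finally show ?thesis using * by simp
next
  case False
  then show ?thesis
    using cosh_sqrt_ge_m1[of x] by linarith
qed

section \<open>Kernels with nonnegative quadratic form and their entrywise products\<close>

definition psd :: "'a set \<Rightarrow> ('a \<Rightarrow> 'a \<Rightarrow> real) \<Rightarrow> bool"
  where "psd X K \<longleftrightarrow> (\<forall>c. 0 \<le> (\<Sum>x\<in>X. \<Sum>y\<in>X. c x * c y * K x y))"

text \<open>Schur's product theorem becomes composition in this form: multipliers are closed under
  entrywise products, and likewise under sums and limits. Gram kernels are multipliers because the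
  factors of a rank one kernel can be absorbed into the coefficients \<open>c\<close>.\<close>

definition psd_multiplier :: "'a set \<Rightarrow> ('a \<Rightarrow> 'a \<Rightarrow> real) \<Rightarrow> bool"
  where "psd_multiplier X G \<longleftrightarrow> (\<forall>K. psd X K \<longrightarrow> psd X (\<lambda>x y. K x y * G x y))"

lemma psd_1: "psd X (\<lambda>x y. 1)"
  unfolding psd_def by (simp flip: sum_product)

lemma psd_multiplierD: "psd_multiplier X G \<Longrightarrow> psd X K \<Longrightarrow> psd X (\<lambda>x y. K x y * G x y)"
  by (simp add: psd_multiplier_def)

lemma psd_multiplier_sum_nonneg:
  assumes "psd_multiplier X G"
  shows "0 \<le> (\<Sum>x\<in>X. \<Sum>y\<in>X. G x y)"
  using psd_multiplierD[OF assms psd_1, unfolded psd_def, THEN spec, of "\<lambda>x. 1"] by simp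

lemma psd_multiplier_const: "0 \<le> a \<Longrightarrow> psd_multiplier X (\<lambda>x y. a)"
  unfolding psd_multiplier_def psd_def
  by (simp add: mult.assoc[symmetric] flip: sum_distrib_right)

lemma psd_multiplier_add:
  "psd_multiplier X G \<Longrightarrow> psd_multiplier X H \<Longrightarrow> psd_multiplier X (\<lambda>x y. G x y + H x y)"
  unfolding psd_multiplier_def psd_def by (simp add: algebra_simps sum.distrib)

lemma psd_multiplier_mult:
  assumes "psd_multiplier X G" "psd_multiplier X H"
  shows "psd_multiplier X (\<lambda>x y. G x y * H x y)"
  unfolding psd_multiplier_def
  using psd_multiplierD[OF assms(2) psd_multiplierD[OF assms(1)]] by (simp add: mult.assoc)

lemma psd_multiplier_sum:
  "(\<And>i. i \<in> I \<Longrightarrow> psd_multiplier X (G i)) \<Longrightarrow> psd_multiplier X (\<lambda>x y. \<Sum>i\<in>I. G i x y)"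
  by (induction I rule: infinite_finite_induct)
    (auto intro: psd_multiplier_add psd_multiplier_const)

lemma psd_multiplier_prod:
  "(\<And>i. i \<in> I \<Longrightarrow> psd_multiplier X (G i)) \<Longrightarrow> psd_multiplier X (\<lambda>x y. \<Prod>i\<in>I. G i x y)"
  by (induction I rule: infinite_finite_induct)
    (auto intro: psd_multiplier_mult psd_multiplier_const)

lemma psd_multiplier_power: "psd_multiplier X G \<Longrightarrow> psd_multiplier X (\<lambda>x y. G x y ^ n)"
  by (induction n) (auto intro: psd_multiplier_mult psd_multiplier_const)

lemma psd_multiplier_tendsto:
  assumes "\<And>n. psd_multiplier X (G n)" "\<And>x y. (\<lambda>n. G n x y) \<longlonglongrightarrow> H x y"
  shows "psd_multiplier X H"
  unfolding psd_multiplier_def psd_def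
proof (intro allI impI)
  fix K :: "'a \<Rightarrow> 'a \<Rightarrow> real" and c :: "'a \<Rightarrow> real"
  assume K: "\<forall>c. 0 \<le> (\<Sum>x\<in>X. \<Sum>y\<in>X. c x * c y * K x y)"
  have "(\<lambda>n. \<Sum>x\<in>X. \<Sum>y\<in>X. c x * c y * (K x y * G n x y))
      \<longlonglongrightarrow> (\<Sum>x\<in>X. \<Sum>y\<in>X. c x * c y * (K x y * H x y))"
    by (intro tendsto_intros assms)
  moreover have "0 \<le> (\<Sum>x\<in>X. \<Sum>y\<in>X. c x * c y * (K x y * G n x y))" for n
    using assms(1)[of n] K by (simp add: psd_multiplier_def psd_def)
  ultimately show "0 \<le> (\<Sum>x\<in>X. \<Sum>y\<in>X. c x * c y * (K x y * H x y))"
    by (intro LIMSEQ_le_const) auto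
qed

text \<open>The partial sums are polynomials in \<open>G\<close> with nonnegative coefficients, and
  pointwise limits of multipliers are multipliers.\<close>

lemma psd_multiplier_cosh_sqrt:
  assumes "psd_multiplier X G"
  shows "psd_multiplier X (\<lambda>x y. cosh_sqrt (G x y))"
proof (rule psd_multiplier_tendsto)
  show "psd_multiplier X (\<lambda>x y. \<Sum>n<N. G x y ^ n / fact (2 * n))" for N
    unfolding divide_inverse
    by (intro psd_multiplier_sum psd_multiplier_mult psd_multiplier_power
        psd_multiplier_const assms) auto
  show "(\<lambda>N. \<Sum>n<N. G x y ^ n / fact (2 * n)) \<longlonglongrightarrow> cosh_sqrt (G x y)" for x y
    using sums_cosh_sqrt by (simp add: sums_def)
qed

lemma psd_multiplier_rank_one: "psd_multiplier X (\<lambda>x y. f x * f y)"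
  unfolding psd_multiplier_def psd_def
proof (intro allI impI)
  fix K :: "'a \<Rightarrow> 'a \<Rightarrow> real" and c :: "'a \<Rightarrow> real"
  assume "\<forall>c. 0 \<le> (\<Sum>x\<in>X. \<Sum>y\<in>X. c x * c y * K x y)"
  from spec[OF this, of "\<lambda>x. c x * f x"]
  show "0 \<le> (\<Sum>x\<in>X. \<Sum>y\<in>X. c x * c y * (K x y * (f x * f y)))"
    by (simp add: mult_ac)
qed

lemma psd_multiplier_gram: "psd_multiplier X (\<lambda>x y. \<Sum>v\<in>A. f x v * f y v)"
  by (intro psd_multiplier_sum psd_multiplier_rank_one)

section \<open>Damped kernels: from a nonnegative average to many good pairs\<close>

definition damp :: "real \<Rightarrow> real"
  where "damp x = 2 + cosh_sqrt x"

lemma damp_ge_1: "1 \<le> damp x"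
  unfolding damp_def using cosh_sqrt_ge_m1[of x] by simp

lemma damp_le: "damp x \<le> 3 * exp (sqrt (max 0 x))"
proof -
  have "1 \<le> exp (sqrt (max 0 x))" by simp
  then show ?thesis unfolding damp_def using cosh_sqrt_le_exp[of x] by linarith
qed

lemma div_damp_le_1: "x / damp x \<le> 1"
  using le_2_plus_cosh_sqrt[of x] damp_ge_1[of x] by (simp add: damp_def divide_le_eq)

lemma sum_prod_damp:
  fixes r :: nat and z :: "nat \<Rightarrow> real"
  shows
  "(\<Sum>j<r. z j * (\<Prod>i\<in>{..<r} - {j}. damp (z i))) = (\<Prod>i<r. damp (z i)) * (\<Sum>j<r. z j / damp (z j))"
proof -
  have "z j * (\<Prod>i\<in>{..<r} - {j}. damp (z i)) = (\<Prod>i<r. damp (z i)) * (z j / damp (z j))" if "j < r" for j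
    using that damp_ge_1[of "z j"] by (subst prod.remove[of "{..<r}" j]) auto
  then show ?thesis by (simp add: sum_distrib_left)
qed

text \<open>On the negative axis \<open>damp\<close> is at most 3, so after factoring out the
  product the term of \<open>j\<close> is at most \<open>- r\<close>, while each of the other
  \<open>r - 1\<close> terms is at most 1. The product itself is at least 1.\<close>

lemma sum_prod_damp_le_m1:
  assumes "j < r" "z j < - 3 * real r"
  shows "(\<Sum>j<r. z j * (\<Prod>i\<in>{..<r} - {j}. damp (z i))) \<le> - 1"
proof -
  have "z j < 0"
    using assms by (smt (verit) of_nat_0_le_iff)
  then have "damp (z j) \<le> 3"
    using damp_le[of "z j"] by (simp add: max_def)
  have "z j / damp (z j) \<le> z j / 3"
    using \<open>damp (z j) \<le> 3\<close> \<open>z j < 0\<close> damp_ge_1[of "z j"] by (intro divide_left_mono_neg) auto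
  also have "\<dots> \<le> - real r" using assms(2) by simp
  finally have *: "z j / damp (z j) \<le> - real r" .
  have "(\<Sum>j<r. z j / damp (z j)) = z j / damp (z j) + (\<Sum>i\<in>{..<r} - {j}. z i / damp (z i))"
    using assms(1) by (subst sum.remove[of _ j]) auto
  also have "(\<Sum>i\<in>{..<r} - {j}. z i / damp (z i)) \<le> (\<Sum>i\<in>{..<r} - {j}. 1)"
    by (intro sum_mono div_damp_le_1)
  also have "\<dots> = real r - 1" using assms(1) by (simp add: of_nat_diff)
  finally have sm: "(\<Sum>j<r. z j / damp (z j)) \<le> - 1" using * by simp
  have "1 \<le> (\<Prod>i<r. damp (z i))" by (intro prod_ge_1 damp_ge_1)
  then have "(\<Prod>i<r. damp (z i)) * (\<Sum>j<r. z j / damp (z j)) \<le> (\<Prod>i<r. damp (z i)) * (- 1)"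
    using sm by (intro mult_left_mono) auto
  also have "\<dots> \<le> - 1" using \<open>1 \<le> (\<Prod>i<r. damp (z i))\<close> by simp
  finally show ?thesis by (simp add: sum_prod_damp)
qed

text \<open>The base \<open>18 = 2 * 3 * 3\<close> collects the factor 3 of \<open>damp_le\<close>
  for each colour and the crude bound \<open>r + 1 <= 2 ^ r * 3 ^ r\<close> for the number of
  summands and the added 1.\<close>

lemma sum_prod_damp_le_exp:
  assumes "1 \<le> r" "\<And>i. i < r \<Longrightarrow> sqrt (max 0 (z i)) \<le> b" "0 \<le> b"
  shows "(\<Sum>j<r. z j * (\<Prod>i\<in>{..<r} - {j}. damp (z i))) + 1 \<le> 18 ^ r * exp (real r * b)"
proof -
  have P: "0 \<le> (\<Prod>i<r. damp (z i))" using damp_ge_1 by (intro prod_nonneg) (smt (verit))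
  have "damp (z i) \<le> 3 * exp b" if "i < r" for i
    using damp_le[of "z i"] assms(2)[OF that] by (smt (verit) exp_le_cancel_iff)
  then have "(\<Prod>i<r. damp (z i)) \<le> (\<Prod>i<r. 3 * exp b)"
    using damp_ge_1 by (intro prod_mono) (auto intro: order_trans[OF zero_le_one])
  also have "\<dots> = 3 ^ r * exp (real r * b)"
    by (simp add: power_mult_distrib exp_of_nat_mult)
  finally have H: "(\<Prod>i<r. damp (z i)) \<le> 3 ^ r * exp (real r * b)" .
  have "(\<Sum>j<r. z j / damp (z j)) \<le> (\<Sum>j<r. 1)" by (intro sum_mono div_damp_le_1)
  then have "(\<Sum>j<r. z j * (\<Prod>i\<in>{..<r} - {j}. damp (z i))) \<le> (\<Prod>i<r. damp (z i)) * real r"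
    unfolding sum_prod_damp using P by (intro mult_left_mono) auto
  also have "\<dots> \<le> 3 ^ r * exp (real r * b) * real r" using H by (intro mult_right_mono) auto
  finally have 1: "(\<Sum>j<r. z j * (\<Prod>i\<in>{..<r} - {j}. damp (z i))) \<le> real r * 3 ^ r * exp (real r * b)"
    by (simp add: mult_ac)
  have "real r + 1 \<le> 2 ^ r * 3 ^ r"
  proof -
    have "real r \<le> 2 ^ r" using less_exp[of r] by (metis of_nat_less_iff of_nat_numeral of_nat_power less_imp_le)
    moreover have "(1::real) \<le> 2 ^ r" by simp
    moreover have "(2::real) \<le> 3 ^ r" using power_increasing[OF assms(1), of "3::real"] by simp
    moreover have "(2::real) ^ r * 2 \<le> 2 ^ r * 3 ^ r" using calculation by (intro mult_left_mono) auto
    ultimately show ?thesis by linarith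
  qed
  then have "(real r + 1) * 3 ^ r \<le> 2 ^ r * 3 ^ r * 3 ^ r"
    by (intro mult_right_mono) auto
  also have "\<dots> = 18 ^ r" by (simp flip: power_mult_distrib)
  finally have "(real r + 1) * 3 ^ r * exp (real r * b) \<le> 18 ^ r * exp (real r * b)"
    by (intro mult_right_mono) auto
  moreover have "1 * 1 \<le> 3 ^ r * exp (real r * b)"
    using assms(3) by (intro mult_mono) auto
  ultimately show ?thesis using 1 by (simp add: algebra_simps)
qed

text \<open>The kernel \<open>\<Sum>j<r. Z j * (\<Prod>i\<noteq>j. damp (Z i))\<close> has a nonnegative average. Where some
  \<open>Z j\<close> is below \<open>- 3 * r\<close> it is at most \<open>- 1\<close>, so the remaining pairs must compensate, and there
  it grows only like the exponential of a square root.\<close>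

lemma gram_kernels_jointly_large:
  fixes Z :: "nat \<Rightarrow> 'a \<Rightarrow> 'a \<Rightarrow> real"
  assumes X: "finite X" "X \<noteq> {}" and r: "1 \<le> r"
    and Z: "\<And>i. i < r \<Longrightarrow> psd_multiplier X (Z i)"
  shows "\<exists>i<r. \<exists>s::nat. exp (- 6 * real r * (real s + 1)) * (real (card X))\<^sup>2
    \<le> real (card {(x, y) \<in> X \<times> X. (\<forall>j<r. - 3 * real r \<le> Z j x y)
      \<and> (0 < s \<longrightarrow> (real s)\<^sup>2 \<le> Z i x y)})"
proof (rule ccontr)
  define Q where "Q = X \<times> X"
  define z where "z q j = Z j (fst q) (snd q)" for q j
  define F where "F q = (\<Sum>j<r. z q j * (\<Prod>i\<in>{..<r} - {j}. damp (z q i)))" for q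
  define E where "E = {q \<in> Q. \<forall>j<r. - 3 * real r \<le> z q j}"
  \<comment> \<open>The integer part of the largest root. At level 0 the largest entry may be
    negative, whence the guard \<open>0 < s\<close> in the statement.\<close>
  define lev where "lev q = Max ((\<lambda>i. nat \<lfloor>sqrt (max 0 (z q i))\<rfloor>) ` {..<r})" for q
  define N where "N = real (card Q)"
  have fQ: "finite Q" and N0: "0 < N" and Nsq: "N = (real (card X))\<^sup>2"
    using X by (auto simp: Q_def N_def card_gt_0_iff power2_eq_square)
  have fE: "finite E" "E \<subseteq> Q" using fQ by (auto simp: E_def)
  assume neg: "\<not> ?thesis"
  then have small: "real (card {q \<in> E. 0 < s \<longrightarrow> (real s)\<^sup>2 \<le> z q i}) < exp (- 6 * real r * (real s + 1)) * N"
    if "i < r" for i and s :: nat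
  proof -
    have "{q \<in> E. 0 < s \<longrightarrow> (real s)\<^sup>2 \<le> z q i} = {(x, y) \<in> X \<times> X. (\<forall>j<r. - 3 * real r \<le> Z j x y)
      \<and> (0 < s \<longrightarrow> (real s)\<^sup>2 \<le> Z i x y)}"
      by (auto simp: E_def Q_def z_def)
    then show ?thesis
      using neg that by (auto simp: Nsq not_le)
  qed
  have lev_ge: "sqrt (max 0 (z q i)) \<le> real (lev q) + 1" if "i < r" for q i
  proof -
    have "nat \<lfloor>sqrt (max 0 (z q i))\<rfloor> \<le> lev q"
      unfolding lev_def using that by (intro Max_ge) auto
    then show ?thesis by linarith
  qed
  have lev_att: "\<exists>i<r. 0 < lev q \<longrightarrow> (real (lev q))\<^sup>2 \<le> z q i" for q
  proof -
    have "lev q \<in> (\<lambda>i. nat \<lfloor>sqrt (max 0 (z q i))\<rfloor>) ` {..<r}"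
      unfolding lev_def using r by (intro Max_in) (auto simp: lessThan_empty_iff)
    then obtain i where i: "i < r" "lev q = nat \<lfloor>sqrt (max 0 (z q i))\<rfloor>" by auto
    have "(real (lev q))\<^sup>2 \<le> z q i" if "0 < lev q"
    proof -
      have le: "real (lev q) \<le> sqrt (max 0 (z q i))"
        unfolding i(2) by (simp add: of_nat_floor)
      have "(real (lev q))\<^sup>2 \<le> max 0 (z q i)"
        using power_mono[OF le of_nat_0_le_iff, of 2] by simp
      moreover have "0 < (real (lev q))\<^sup>2" using that by simp
      ultimately show ?thesis by linarith
    qed
    with i(1) show ?thesis by (intro exI[of _ i]) simp
  qed
  have lev_card: "real (card {q \<in> E. lev q = s}) \<le> real r * exp (- 6 * real r * (real s + 1)) * N" for s
  proof -
    have "{q \<in> E. lev q = s} \<subseteq> (\<Union>i<r. {q \<in> E. 0 < s \<longrightarrow> (real s)\<^sup>2 \<le> z q i})"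
    proof
      fix q assume "q \<in> {q \<in> E. lev q = s}"
      moreover from lev_att[of q] obtain i where "i < r" "0 < lev q \<longrightarrow> (real (lev q))\<^sup>2 \<le> z q i"
        by (elim exE conjE)
      ultimately show "q \<in> (\<Union>i<r. {q \<in> E. 0 < s \<longrightarrow> (real s)\<^sup>2 \<le> z q i})"
        by (intro UN_I[of i]) auto
    qed
    then have "card {q \<in> E. lev q = s} \<le> card (\<Union>i<r. {q \<in> E. 0 < s \<longrightarrow> (real s)\<^sup>2 \<le> z q i})"
      using fE by (intro card_mono) auto
    also have "\<dots> \<le> (\<Sum>i<r. card {q \<in> E. 0 < s \<longrightarrow> (real s)\<^sup>2 \<le> z q i})"
      by (intro card_UN_le) auto
    finally have "real (card {q \<in> E. lev q = s}) \<le> (\<Sum>i<r. real (card {q \<in> E. 0 < s \<longrightarrow> (real s)\<^sup>2 \<le> z q i}))"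
      unfolding of_nat_sum[symmetric] of_nat_le_iff .
    also have "\<dots> \<le> (\<Sum>i<r. exp (- 6 * real r * (real s + 1)) * N)"
      using small by (intro sum_mono less_imp_le) auto
    finally show ?thesis by simp
  qed
  have "psd_multiplier X (\<lambda>x y. F (x, y))"
    unfolding F_def z_def damp_def fst_conv snd_conv
    by (intro psd_multiplier_sum psd_multiplier_mult psd_multiplier_prod psd_multiplier_add
        psd_multiplier_const psd_multiplier_cosh_sqrt Z) auto
  from psd_multiplier_sum_nonneg[OF this]
  have "0 \<le> (\<Sum>q\<in>Q. F q)"
    by (simp add: Q_def sum.cartesian_product)
  also have "\<dots> = (\<Sum>q\<in>E. F q) + (\<Sum>q\<in>Q - E. F q)"
    using fQ fE by (metis add.commute sum.subset_diff)
  \<comment> \<open>Each pair outside \<open>E\<close> contributes at most -1, so the sum of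
    \<open>F + 1\<close> over \<open>E\<close> must reach the number \<open>N\<close> of all pairs.
    The level sets turn out to be too small for that.\<close>
  also have "(\<Sum>q\<in>Q - E. F q) \<le> (\<Sum>q\<in>Q - E. - 1)"
  proof (rule sum_mono)
    fix q assume "q \<in> Q - E"
    then obtain j where "j < r" "z q j < - 3 * real r" by (auto simp: E_def not_le)
    then show "F q \<le> - 1" unfolding F_def by (rule sum_prod_damp_le_m1)
  qed
  also have "(\<Sum>q\<in>Q - E. - 1::real) = - (N - real (card E))"
    using fE fQ card_mono[OF fQ fE(2)] by (simp add: N_def card_Diff_subset of_nat_diff)
  finally have "N \<le> (\<Sum>q\<in>E. F q + 1)" by (simp add: sum.distrib)
  also have "\<dots> \<le> (\<Sum>q\<in>E. 18 ^ r * exp (real r * (real (lev q) + 1)))"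
    unfolding F_def using lev_ge r by (intro sum_mono sum_prod_damp_le_exp) auto
  also have "\<dots> = (\<Sum>s\<in>lev ` E. \<Sum>q\<in>{q \<in> E. lev q = s}. 18 ^ r * exp (real r * (real (lev q) + 1)))"
    by (rule sum.image_gen[OF fE(1)])
  also have "\<dots> = (\<Sum>s\<in>lev ` E. real (card {q \<in> E. lev q = s}) * (18 ^ r * exp (real r * (real s + 1))))"
    by (intro sum.cong) auto
  also have "\<dots> \<le> (\<Sum>s\<in>lev ` E. N * (1 / 2) ^ Suc s)"
  proof (rule sum_mono)
    fix s
    \<comment> \<open>Since \<open>r * 18 ^ r <= 36 ^ r\<close> and \<open>72 = 2 * 36\<close>, the
      spare factor \<open>exp (- 5 * r * (s + 1))\<close> leaves a geometric series in
      \<open>s\<close>.\<close>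
    have e: "72 \<le> exp (5::real)"
    proof -
      have "(5 / 2) ^ 5 \<le> exp (1::real) ^ 5"
        using exp_lower_Taylor_quadratic[of "1::real"] by (intro power_mono) auto
      moreover have "(72::real) \<le> (5 / 2) ^ 5" by (simp add: power_divide)
      moreover have "exp 1 ^ 5 = exp (5::real)" using exp_of_nat_mult[of 5 "1::real"] by simp
      ultimately show ?thesis by linarith
    qed
    have rr: "real r \<le> 2 ^ r"
      using less_exp[of r] by (metis of_nat_less_iff of_nat_numeral of_nat_power less_imp_le)
    have "real (card {q \<in> E. lev q = s}) * (18 ^ r * exp (real r * (real s + 1)))
        \<le> real r * exp (- 6 * real r * (real s + 1)) * N * (18 ^ r * exp (real r * (real s + 1)))"
      using lev_card by (intro mult_right_mono) auto
    also have "\<dots> = N * (real r * 18 ^ r * exp (- 5 * real r * (real s + 1)))"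
      by (simp add: mult_ac flip: exp_add) (simp add: algebra_simps)
    also have "\<dots> \<le> N * (2 ^ r * 18 ^ r * exp (- 5 * real r * (real s + 1)))"
      using N0 rr by (intro mult_left_mono mult_right_mono) auto
    also have "2 ^ r * 18 ^ r = (36::real) ^ r" by (simp flip: power_mult_distrib)
    also have "exp (- 5 * real r * (real s + 1)) = 1 / exp 5 ^ (r * Suc s)"
    proof -
      have "- 5 * real r * (real s + 1) = - (real (r * Suc s) * 5)"
        by (simp add: algebra_simps)
      then show ?thesis
        by (simp only: exp_minus exp_of_nat_mult inverse_eq_divide)
    qed
    also have "N * (36 ^ r * (1 / exp 5 ^ (r * Suc s))) \<le> N * (36 ^ r * (1 / 72 ^ (r * Suc s)))"
      using N0 e by (intro mult_left_mono divide_left_mono power_mono mult_pos_pos) auto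
    also have "\<dots> \<le> N * (36 ^ (r * Suc s) * (1 / 72 ^ (r * Suc s)))"
      using N0 by (intro mult_left_mono mult_right_mono power_increasing) auto
    also have "36 ^ (r * Suc s) * (1 / 72 ^ (r * Suc s)) = (1 / 2 :: real) ^ (r * Suc s)"
      by (simp flip: power_divide)
    also have "N * (1 / 2) ^ (r * Suc s) \<le> N * (1 / 2) ^ Suc s"
      using N0 mult_le_mono1[OF r, of "Suc s"] by (intro mult_left_mono power_decreasing) auto
    finally show "real (card {q \<in> E. lev q = s}) * (18 ^ r * exp (real r * (real s + 1))) \<le> N * (1 / 2) ^ Suc s" .
  qed
  also have "\<dots> = N * (\<Sum>s\<in>lev ` E. (1 / 2) ^ Suc s)" by (simp add: sum_distrib_left)
  \<comment> \<open>Only finitely many levels occur, so the geometric sum stays strictly below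
    1.\<close>
  also have "\<dots> < N * 1"
  proof -
    obtain m where "lev ` E \<subseteq> {..<m}" using fE by (meson finite_imageI finite_nat_iff_bounded)
    then have "(\<Sum>s\<in>lev ` E. (1 / 2 :: real) ^ Suc s) \<le> (\<Sum>s<m. (1 / 2) ^ Suc s)"
      by (intro sum_mono2) auto
    also have "\<dots> = 1 - (1 / 2) ^ m"
      by (induction m) auto
    finally have "(\<Sum>s\<in>lev ` E. (1 / 2 :: real) ^ Suc s) < 1"
      by (smt (verit) zero_less_power zero_less_divide_1_iff)
    then show ?thesis using N0 by simp
  qed
  finally show False by simp
qed

section \<open>The book algorithm\<close>

text \<open>The factor \<open>p * card Y / card A\<close> gives every vector the same sum over \<open>Y\<close>, namely \<open>0\<close>, without
  cutting \<open>A\<close> down to \<open>p * card Y\<close> elements (which need not be an integer).\<close>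

definition nbhd_vec :: "real \<Rightarrow> real \<Rightarrow> 'b set \<Rightarrow> 'b set \<Rightarrow> 'b \<Rightarrow> real"
  where "nbhd_vec p \<alpha> Y A v =
    (p * real (card Y) / real (card A) * (if v \<in> A then 1 else 0) - p) / sqrt (\<alpha> * p * real (card Y))"

text \<open>In the expanded product both linear terms sum to \<open>p^2 * card Y\<close>, by the
  normalisation \<open>a * card A = p * card Y\<close> and likewise for \<open>B\<close>. What
  remains compares \<open>a * b * card (B \<inter> A)\<close> with \<open>p^2 * card Y\<close>, and
  \<open>b <= 1\<close> since \<open>B\<close> is large enough.\<close>

lemma nbhd_vec_inner:
  assumes Y: "finite Y" "Y \<noteq> {}" and p: "0 < p" "0 < \<alpha>"
    and AB: "A \<subseteq> Y" "B \<subseteq> Y"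
    and dA: "p * real (card Y) \<le> real (card A)" and dB: "p * real (card Y) \<le> real (card B)"
    and z: "z \<le> (\<Sum>v\<in>Y. nbhd_vec p \<alpha> Y A v * nbhd_vec p \<alpha> Y B v)"
  shows "(p + z * \<alpha>) * real (card A) \<le> real (card (B \<inter> A))"
proof -
  define y where "y = real (card Y)"
  define a where "a = p * y / real (card A)"
  define b where "b = p * y / real (card B)"
  have y0: "0 < y" using Y by (simp add: y_def card_gt_0_iff)
  have py: "0 < p * y" using p y0 by simp
  have cA: "0 < real (card A)" and cB: "0 < real (card B)"
    using py dA dB by (auto simp: y_def intro: less_le_trans)
  have a: "a * real (card A) = p * y" "0 < a" using cA py by (auto simp: a_def)
  have b: "b * real (card B) = p * y" "0 < b" "b \<le> 1"
    using cB py dB by (auto simp: b_def y_def divide_le_eq)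
  have ind: "(\<Sum>v\<in>Y. c * (if v \<in> C then 1 else 0)) = c * real (card C)" if "C \<subseteq> Y" for c :: real and C
    using that Y by (simp add: sum.If_cases Int_absorb1 flip: sum_distrib_left)
  define C where "C = B \<inter> A"
  have "nbhd_vec p \<alpha> Y A v * nbhd_vec p \<alpha> Y B v
      = (a * b * (if v \<in> C then 1 else 0) - p * a * (if v \<in> A then 1 else 0)
        - p * b * (if v \<in> B then 1 else 0) + p\<^sup>2) / (\<alpha> * p * y)" for v
  proof -
    have "sqrt (\<alpha> * p * y) * sqrt (\<alpha> * p * y) = \<alpha> * p * y"
      using p y0 by simp
    then show ?thesis
      unfolding nbhd_vec_def times_divide_times_eq y_def[symmetric] a_def[symmetric] b_def[symmetric]
      by (simp add: C_def algebra_simps power2_eq_square)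
  qed
  then have "(\<Sum>v\<in>Y. nbhd_vec p \<alpha> Y A v * nbhd_vec p \<alpha> Y B v)
      = (\<Sum>v\<in>Y. a * b * (if v \<in> C then 1 else 0) - p * a * (if v \<in> A then 1 else 0)
        - p * b * (if v \<in> B then 1 else 0) + p\<^sup>2) / (\<alpha> * p * y)"
    by (simp only: sum_divide_distrib)
  also have "\<dots> = (a * b * real (card C) - p * a * real (card A) - p * b * real (card B) + p\<^sup>2 * y) / (\<alpha> * p * y)"
    using AB by (simp only: ind sum.distrib sum_subtractf C_def le_infI1 sum_constant y_def mult.commute)
  also have "\<dots> = (a * b * real (card C) - p * (p * y)) / (\<alpha> * p * y)"
    using a(1) b(1) by (simp add: mult.assoc power2_eq_square)
  finally have "z * (\<alpha> * p * y) \<le> a * b * real (card (B \<inter> A)) - p * (p * y)"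
    using z p y0 by (simp add: C_def pos_le_divide_eq)
  then have "(p + z * \<alpha>) * (p * y) \<le> a * b * real (card (B \<inter> A))"
    by (simp add: algebra_simps)
  also have "\<dots> \<le> a * 1 * real (card (B \<inter> A))"
    using a b by (intro mult_right_mono mult_left_mono) auto
  finally have "a * ((p + z * \<alpha>) * real (card A)) \<le> a * real (card (B \<inter> A))"
    unfolding a(1)[symmetric] by (simp add: mult_ac)
  then show ?thesis using a(2) by simp
qed

text \<open>The kernel bound is applied to the Gram kernels of the neighbourhood vectors. The good
  pairs split into fibres \<open>G x\<close>; one of at least average size serves as
  \<open>X'\<close>. The free scales \<open>\<alpha> i\<close> are the units of loss and
  gain.\<close>

lemma density_step:
  fixes N :: "nat \<Rightarrow> 'a \<Rightarrow> 'b set"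
  assumes X: "finite X" "X \<noteq> {}" and r: "1 \<le> r"
    and Y: "\<And>i. i < r \<Longrightarrow> finite (Y i) \<and> Y i \<noteq> {}"
    and p: "\<And>i. i < r \<Longrightarrow> 0 < p i" "\<And>i. i < r \<Longrightarrow> 0 < \<alpha> i"
    and deg: "\<And>i x. i < r \<Longrightarrow> x \<in> X \<Longrightarrow> p i * real (card (Y i)) \<le> real (card (N i x \<inter> Y i))"
  obtains x X' i and s :: nat where "x \<in> X" "X' \<subseteq> X" "i < r"
    "exp (- 6 * real r * (real s + 1)) * real (card X) \<le> real (card X')"
    "\<And>y j. y \<in> X' \<Longrightarrow> j < r \<Longrightarrow> (p j - 3 * real r * \<alpha> j) * real (card (N j x \<inter> Y j))
      \<le> real (card (N j y \<inter> (N j x \<inter> Y j)))"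
    "\<And>y. y \<in> X' \<Longrightarrow> 0 < s \<Longrightarrow> (p i + (real s)\<^sup>2 * \<alpha> i) * real (card (N i x \<inter> Y i))
      \<le> real (card (N i y \<inter> (N i x \<inter> Y i)))"
proof -
  define Z where "Z i x y = (\<Sum>v\<in>Y i. nbhd_vec (p i) (\<alpha> i) (Y i) (N i x \<inter> Y i) v
    * nbhd_vec (p i) (\<alpha> i) (Y i) (N i y \<inter> Y i) v)" for i x y
  have "psd_multiplier X (Z i)" for i
    unfolding Z_def by (rule psd_multiplier_gram)
  with gram_kernels_jointly_large[OF X r, of Z] obtain i s where i: "i < r"
    and big: "exp (- 6 * real r * (real s + 1)) * (real (card X))\<^sup>2
    \<le> real (card {(x, y) \<in> X \<times> X. (\<forall>j<r. - 3 * real r \<le> Z j x y)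
      \<and> (0 < s \<longrightarrow> (real s)\<^sup>2 \<le> Z i x y)})"
    by blast
  define G where "G x = {y \<in> X. (\<forall>j<r. - 3 * real r \<le> Z j x y) \<and> (0 < s \<longrightarrow> (real s)\<^sup>2 \<le> Z i x y)}" for x
  have "{(x, y) \<in> X \<times> X. (\<forall>j<r. - 3 * real r \<le> Z j x y) \<and> (0 < s \<longrightarrow> (real s)\<^sup>2 \<le> Z i x y)} = Sigma X G"
    by (auto simp: G_def)
  then have big': "exp (- 6 * real r * (real s + 1)) * (real (card X))\<^sup>2 \<le> (\<Sum>x\<in>X. real (card (G x)))"
    using big X by (simp add: G_def)
  have "\<exists>x\<in>X. exp (- 6 * real r * (real s + 1)) * real (card X) \<le> real (card (G x))"
  proof (rule ccontr)
    assume "\<not> ?thesis"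
    then have "(\<Sum>x\<in>X. real (card (G x))) < (\<Sum>x\<in>X. exp (- 6 * real r * (real s + 1)) * real (card X))"
      using X by (intro sum_strict_mono) (auto simp: not_le)
    then show False using big' by (simp add: power2_eq_square mult_ac)
  qed
  then obtain x where x: "x \<in> X" "exp (- 6 * real r * (real s + 1)) * real (card X) \<le> real (card (G x))"
    by blast
  have step: "(p j + z * \<alpha> j) * real (card (N j x \<inter> Y j)) \<le> real (card (N j y \<inter> (N j x \<inter> Y j)))"
    if "j < r" "y \<in> X" "z \<le> Z j x y" for j y z
  proof -
    have "(p j + z * \<alpha> j) * real (card (N j x \<inter> Y j)) \<le> real (card ((N j y \<inter> Y j) \<inter> (N j x \<inter> Y j)))"
      using that Y[OF that(1)] p[OF that(1)] deg[OF that(1)] x(1)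
      by (intro nbhd_vec_inner[of "Y j"]) (auto simp: Z_def)
    also have "(N j y \<inter> Y j) \<inter> (N j x \<inter> Y j) = N j y \<inter> (N j x \<inter> Y j)" by blast
    finally show ?thesis .
  qed
  show thesis
  proof (rule that[OF x(1) _ i x(2)])
    show "G x \<subseteq> X" by (auto simp: G_def)
  next
    fix y j assume "y \<in> G x" "j < r"
    then show "(p j - 3 * real r * \<alpha> j) * real (card (N j x \<inter> Y j)) \<le> real (card (N j y \<inter> (N j x \<inter> Y j)))"
      using step[of j y "- 3 * real r"] by (auto simp: G_def)
  next
    fix y assume "y \<in> G x" "0 < s"
    then show "(p i + (real s)\<^sup>2 * \<alpha> i) * real (card (N i x \<inter> Y i)) \<le> real (card (N i y \<inter> (N i x \<inter> Y i)))"
      using step[OF i, of y "(real s)\<^sup>2"] by (auto simp: G_def)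
  qed
qed

lemma ln_one_plus_ge_half:
  fixes u :: real
  assumes "0 \<le> u" "u \<le> 1"
  shows "u / 2 \<le> ln (1 + u)"
proof -
  have "exp (u / 2) \<le> 1 + u / 2 + (u / 2)\<^sup>2" using assms by (intro exp_bound) auto
  also have "(u / 2)\<^sup>2 \<le> u / 2"
    using assms power_decreasing[of 1 2 "u / 2"] by simp
  finally show ?thesis using assms by (subst ln_ge_iff) auto
qed

lemma half_le_ln_2: "1 / 2 \<le> ln (2 :: real)"
  using ln_one_plus_ge_half[of 1] by simp

section \<open>Edge colourings, monochromatic cliques and books\<close>

locale edge_coloring =
  fixes c :: "'a set \<Rightarrow> nat" and V :: "'a set" and r :: nat
  assumes finV: "finite V"
    and col: "x \<in> V \<Longrightarrow> y \<in> V \<Longrightarrow> x \<noteq> y \<Longrightarrow> c {x, y} < r"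
begin

definition nbr :: "nat \<Rightarrow> 'a \<Rightarrow> 'a set"
  where "nbr i x = {y. y \<noteq> x \<and> c {x, y} = i}"

definition clique :: "nat \<Rightarrow> 'a set \<Rightarrow> bool"
  where "clique i H \<longleftrightarrow> (\<forall>x\<in>H. \<forall>y\<in>H. x \<noteq> y \<longrightarrow> c {x, y} = i)"

text \<open>\<open>T\<close> is the spine and \<open>Z\<close> the pages. They are disjoint even if
  \<open>X\<close> and \<open>Y\<close> overlap, because \<open>nbr i x\<close> omits
  \<open>x\<close>. A real \<open>m\<close> avoids rounding.\<close>

definition has_book :: "nat \<Rightarrow> 'a set \<Rightarrow> 'a set \<Rightarrow> nat \<Rightarrow> real \<Rightarrow> bool"
  where "has_book i X Y n m \<longleftrightarrow> (\<exists>T Z. T \<subseteq> X \<and> card T = n \<and> clique i T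
    \<and> Z \<subseteq> Y \<and> m \<le> real (card Z) \<and> (\<forall>x\<in>T. Z \<subseteq> nbr i x))"

lemma clique_insert: "clique i H \<Longrightarrow> H \<subseteq> nbr i x \<Longrightarrow> clique i (insert x H)"
  by (auto simp: clique_def nbr_def insert_commute)

lemma has_book_mono:
  assumes "has_book i X Y n m" "X \<subseteq> X'" "Y \<subseteq> Y'"
  shows "has_book i X' Y' n m"
proof -
  obtain T Z where TZ: "T \<subseteq> X" "card T = n" "clique i T" "Z \<subseteq> Y" "m \<le> real (card Z)"
      "\<forall>x\<in>T. Z \<subseteq> nbr i x"
    using assms(1) by (auto simp: has_book_def)
  then show ?thesis
    unfolding has_book_def using assms(2,3) by (intro exI[of _ T] exI[of _ Z]) auto
qed

lemma has_book_0: "m \<le> real (card Y) \<Longrightarrow> has_book i X Y 0 m"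
  unfolding has_book_def by (intro exI[of _ "{}"] exI[of _ Y]) (auto simp: clique_def)

lemma has_book_Suc:
  assumes "has_book i X' Y' n m" "x \<in> X" "X' \<subseteq> X" "finite X" "X' \<subseteq> nbr i x" "Y' \<subseteq> nbr i x" "Y' \<subseteq> Y"
  shows "has_book i X Y (Suc n) m"
proof -
  obtain T Z where TZ: "T \<subseteq> X'" "card T = n" "clique i T" "Z \<subseteq> Y'" "m \<le> real (card Z)"
      "\<forall>x\<in>T. Z \<subseteq> nbr i x"
    using assms(1) by (auto simp: has_book_def)
  have "x \<notin> T" "finite T"
    using TZ(1) assms by (auto simp: nbr_def intro: finite_subset)
  then show ?thesis
    unfolding has_book_def using TZ assms clique_insert[of i T x]
    by (intro exI[of _ "insert x T"] exI[of _ Z]) auto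
qed

lemma sum_card_nbr:
  assumes "x \<in> V" "X \<subseteq> V"
  shows "(\<Sum>i<r. card (nbr i x \<inter> X)) = card (X - {x})"
proof -
  have "X - {x} = (\<Union>i<r. nbr i x \<inter> X)"
    using assms col by (auto simp: nbr_def)
  moreover have "finite X" using assms finV finite_subset by auto
  then have "card (\<Union>i<r. nbr i x \<inter> X) = (\<Sum>i<r. card (nbr i x \<inter> X))"
    by (intro card_UN_disjoint) (auto simp: nbr_def)
  ultimately show ?thesis by simp
qed

text \<open>The colours partition \<open>X - {x}\<close>; the factor 2 pays for the removed vertex
  because \<open>X\<close> has at least two.\<close>

lemma ex_large_nbr:
  assumes "x \<in> V" "X \<subseteq> V" "2 \<le> card X"
  obtains j where "j < r" "real (card X) \<le> 2 * real r * real (card (nbr j x \<inter> X))"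
proof -
  have "\<exists>j<r. real (card X) \<le> 2 * real r * real (card (nbr j x \<inter> X))"
  proof (rule ccontr)
    assume neg: "\<not> ?thesis"
    have "finite X" using assms finV finite_subset by auto
    then have "real (card X) \<le> 2 * real (card (X - {x}))"
      using assms(3) by (cases "x \<in> X") (auto simp: card_Diff_singleton)
    also have "\<dots> = 2 * (\<Sum>j<r. real (card (nbr j x \<inter> X)))"
      using sum_card_nbr[OF assms(1,2)] by (metis of_nat_sum)
    finally have le: "real (card X) \<le> 2 * (\<Sum>j<r. real (card (nbr j x \<inter> X)))" .
    have "r \<noteq> 0" using le assms(3) by (intro notI) auto
    then have "(\<Sum>j<r. 2 * real r * real (card (nbr j x \<inter> X))) < (\<Sum>j<r. real (card X))"
      using neg by (intro sum_strict_mono) (auto simp: not_le lessThan_empty_iff)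
    also have "\<dots> = real r * real (card X)" by simp
    also have "\<dots> \<le> real r * (2 * (\<Sum>j<r. real (card (nbr j x \<inter> X))))"
      using le by (intro mult_left_mono) auto
    finally show False by (simp add: sum_distrib_left mult_ac)
  qed
  then show thesis using that by blast
qed

end

section \<open>The state of the book algorithm, its costs and its two kinds of steps\<close>

lemma sum_fun_upd_lessThan:
  fixes f :: "nat \<Rightarrow> 'b \<Rightarrow> 'c :: ab_group_add"
  assumes "i < r"
  shows "(\<Sum>j<r. f j ((g(i := v)) j)) = (\<Sum>j<r. f j (g j)) + (f i v - f i (g i))"
proof -
  have "(\<Sum>j\<in>{..<r} - {i}. f j ((g(i := v)) j)) = (\<Sum>j\<in>{..<r} - {i}. f j (g j))"
    by (intro sum.cong) auto
  then show ?thesis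
    using assms by (simp add: sum.remove[of "{..<r}" i])
qed

text \<open>The aim is a spine of \<open>t\<close> vertices with at least \<open>m\<close> pages. A
  level \<open>s >= S\<close> in \<open>density_step\<close> counts as a boost, \<open>P\<close> is
  the density floor and \<open>L\<close> the initial budget of each colour. \<open>S_le\<close>
  keeps the smallest boost at most 1, and \<open>S_le'\<close> controls boosts larger than
  1.\<close>

locale book_params = edge_coloring c V r for c :: "'a set \<Rightarrow> nat" and V r +
  fixes t S :: nat and P L m :: real
  assumes r1: "1 \<le> r" and t2: "2 \<le> t" and S1: "1 \<le> S" and P0: "0 < P" and m0: "0 < m"
    and S_le: "S\<^sup>2 \<le> 3 * r * t"
    and S_le': "3 * (real S)\<^sup>2 \<le> exp (2 - L) * real r * real t"
begin

text \<open>In state \<open>admissible X Y n a\<close> of the book algorithm, \<open>n i\<close> vertices are still missing from the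
  book of colour \<open>i\<close>, and \<open>a i\<close> is what is left of the logarithmic budget for increments of the
  density in colour \<open>i\<close>. The density of colour \<open>i\<close> is at least \<open>P + excess (n i) (a i)\<close>: adding a
  vertex to the book costs a factor \<open>1 - 1 / t\<close> of the excess, while a boost multiplies it by
  \<open>1 + u\<close> at the price \<open>ln (1 + u)\<close>. As densities are at most \<open>1\<close>, the budget \<open>L\<close> suffices.\<close>

definition decay :: real where "decay = - ln (1 - 1 / real t)"
text \<open>A colour step shrinks \<open>X\<close> by \<open>exp (- 6 * r * (s + 1))\<close> with
  \<open>s + 1 <= S\<close>, and by a factor \<open>2 * r\<close> for choosing a popular colour. The
  boost costs are rates per unit of \<open>ln (1 + u)\<close>: logarithmic loss for
  \<open>X\<close>, number of factors \<open>P\<close> for \<open>Y i\<close>.\<close>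

definition colour_cost :: real where "colour_cost = 6 * real r * real S + ln (2 * real r)"
definition boost_cost_X :: real where "boost_cost_X = 72 * (real r)\<^sup>2 * real t / real S"
definition boost_cost_Y :: real where "boost_cost_Y = 6 * real r * real t / (real S)\<^sup>2"

definition excess :: "nat \<Rightarrow> real \<Rightarrow> real"
  where "excess n a = exp (2 - a - (real t - real n) * decay)"

lemma exp_decay: "exp (- decay) = 1 - 1 / real t"
  using t2 by (simp add: decay_def)

lemma decay_pos: "0 \<le> decay"
  using t2 by (simp add: decay_def ln_le_zero_iff)

text \<open>Up to \<open>t\<close> colour steps shrink the excess by at most \<open>exp 2\<close>,
  which is what the 2 in \<open>excess\<close> compensates.\<close>

lemma decay_le: "real t * decay \<le> 2"
proof -
  have "- (1 / real t) - 2 * (1 / real t)\<^sup>2 \<le> ln (1 - 1 / real t)"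
    using t2 by (intro ln_one_minus_pos_lower_bound) (auto simp: divide_le_eq)
  then have "decay \<le> 1 / real t + 2 * (1 / real t)\<^sup>2"
    unfolding decay_def by simp
  then have "real t * decay \<le> real t * (1 / real t + 2 * (1 / real t)\<^sup>2)"
    by (intro mult_left_mono) auto
  also have "\<dots> = 1 + 2 / real t" using t2 by (simp add: field_simps power2_eq_square)
  also have "\<dots> \<le> 2" using t2 by (simp add: divide_le_eq)
  finally show ?thesis .
qed

lemma decay_diff_le:
  assumes "n \<le> t"
  shows "(real t - real n) * decay \<le> 2"
  using decay_le decay_pos by (smt (verit) mult_right_mono of_nat_0_le_iff)

text \<open>The logarithmic loss of \<open>X\<close> is linear in \<open>s\<close> and
  \<open>u\<close> is quadratic, so for \<open>u <= 1\<close> the bounds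
  \<open>u / 2 <= ln (1 + u)\<close> and \<open>S <= s\<close> suffice. For larger \<open>u\<close>
  the cap on \<open>u\<close> and \<open>S_le'\<close> bound \<open>s * S\<close> by
  \<open>3 * r * t\<close>.\<close>

lemma boost_cost_le:
  assumes s: "S \<le> s" and u: "u = (real s)\<^sup>2 / (3 * real r * real t)" "u * exp (2 - L) \<le> 9"
  shows "6 * real r * (real s + 1) \<le> boost_cost_X * ln (1 + u)" "1 \<le> boost_cost_Y * ln (1 + u)"
proof -
  have rt: "0 < real r" "0 < real t" "0 < real S" "0 < real s" using r1 t2 S1 s by auto
  have u0: "0 < u" unfolding u using rt by simp
  have s2: "(real s)\<^sup>2 = 3 * real r * real t * u" unfolding u using rt by simp
  have "6 * real r * (real s + 1) \<le> 12 * real r * real s"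
    using rt s S1 by (simp add: algebra_simps)
  also have "12 * real r * real s \<le> boost_cost_X * ln (1 + u)"
  proof (cases "u \<le> 1")
    case True
    have "12 * real r * real s * real S \<le> 12 * real r * real s * real s"
      using s by (intro mult_left_mono) auto
    also have "\<dots> = 72 * (real r)\<^sup>2 * real t * (u / 2)"
      using s2 by (simp add: power2_eq_square)
    also have "\<dots> \<le> 72 * (real r)\<^sup>2 * real t * ln (1 + u)"
      using u0 True by (intro mult_left_mono ln_one_plus_ge_half) auto
    finally show ?thesis using rt by (simp add: boost_cost_X_def pos_le_divide_eq)
  next
    case False
    have "(real s * real S)\<^sup>2 * exp (2 - L) = (real S)\<^sup>2 * (3 * real r * real t) * (u * exp (2 - L))"
      by (simp add: power_mult_distrib s2)
    also have "\<dots> \<le> (real S)\<^sup>2 * (3 * real r * real t) * 9"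
      using u(2) by (intro mult_left_mono) auto
    also have "\<dots> = (3 * (real S)\<^sup>2) * (9 * real r * real t)" by simp
    also have "\<dots> \<le> (exp (2 - L) * real r * real t) * (9 * real r * real t)"
      using S_le' by (intro mult_right_mono) auto
    also have "\<dots> = (3 * real r * real t)\<^sup>2 * exp (2 - L)" by (simp add: power2_eq_square)
    finally have "(real s * real S)\<^sup>2 \<le> (3 * real r * real t)\<^sup>2" by simp
    then have "real s * real S \<le> 3 * real r * real t"
      by (rule power2_le_imp_le) auto
    then have "12 * real r * (real s * real S) \<le> 12 * real r * (3 * real r * real t)"
      by (intro mult_left_mono) auto
    also have "\<dots> = 72 * (real r)\<^sup>2 * real t * (1 / 2)" by (simp add: power2_eq_square)
    also have "\<dots> \<le> 72 * (real r)\<^sup>2 * real t * ln (1 + u)"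
    proof (rule mult_left_mono)
      have "ln 2 \<le> ln (1 + u)" using False by (subst ln_le_cancel_iff) auto
      then show "1 / 2 \<le> ln (1 + u)" using half_le_ln_2 by linarith
    qed auto
    finally show ?thesis using rt by (simp add: boost_cost_X_def pos_le_divide_eq mult.assoc)
  qed
  finally show "6 * real r * (real s + 1) \<le> boost_cost_X * ln (1 + u)" .
  \<comment> \<open>The value of \<open>u\<close> at the threshold \<open>S\<close>; it is at most
    1, so the linear bound for the logarithm applies.\<close>
  define v where "v = (real S)\<^sup>2 / (3 * real r * real t)"
  have "real (S\<^sup>2) \<le> real (3 * r * t)" using S_le by (rule of_nat_mono)
  then have v: "0 < v" "v \<le> 1" "v \<le> u"
    using rt s by (auto simp: v_def u(1) divide_le_eq intro!: divide_right_mono power_mono)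
  have "1 = boost_cost_Y * (v / 2)" using rt by (simp add: boost_cost_Y_def v_def)
  also have "\<dots> \<le> boost_cost_Y * ln (1 + v)"
    using v by (intro mult_left_mono ln_one_plus_ge_half) (auto simp: boost_cost_Y_def)
  also have "\<dots> \<le> boost_cost_Y * ln (1 + u)"
    using v by (intro mult_left_mono) (auto simp: boost_cost_Y_def)
  finally show "1 \<le> boost_cost_Y * ln (1 + u)" .
qed

definition admissible :: "'a set \<Rightarrow> (nat \<Rightarrow> 'a set) \<Rightarrow> (nat \<Rightarrow> nat) \<Rightarrow> (nat \<Rightarrow> real) \<Rightarrow> bool"
  where "admissible X Y n a \<longleftrightarrow> X \<subseteq> V
    \<and> exp (\<Sum>i<r. real (n i) * colour_cost + a i * boost_cost_X) \<le> real (card X)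
    \<and> (\<forall>i<r. Y i \<subseteq> V \<and> n i \<le> t \<and> a i \<le> L
      \<and> m * (1 / P) powr (real (n i) + a i * boost_cost_Y) \<le> real (card (Y i))
      \<and> (\<forall>x\<in>X. (P + excess (n i) (a i)) * real (card (Y i)) \<le> real (card (nbr i x \<inter> Y i))))"

text \<open>Any vertex of \<open>X\<close> shows that the density is at most 1, so the excess is
  below 1. Since decay takes at most 2 from its exponent, \<open>a i\<close> cannot be negative.
  Conversely \<open>a i <= L\<close> and \<open>exp 2 <= 9\<close> keep the excess from becoming
  much smaller than \<open>exp (2 - L)\<close>.\<close>

lemma admissible_bounds:
  assumes adm: "admissible X Y n a" and i: "i < r"
  shows "finite X" "X \<noteq> {}" "finite (Y i)" "Y i \<noteq> {}" "P + excess (n i) (a i) \<le> 1" "0 \<le> a i"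
    "exp (2 - L) \<le> 9 * excess (n i) (a i)"
proof -
  from adm i have n: "n i \<le> t" and a: "a i \<le> L" by (auto simp: admissible_def)
  show fX: "finite X" and fY: "finite (Y i)"
    using adm i finite_subset[OF _ finV] by (auto simp: admissible_def)
  have "0 < real (card X)"
    using adm unfolding admissible_def by (meson exp_gt_zero less_le_trans)
  then show X: "X \<noteq> {}" by auto
  have "0 < m * (1 / P) powr (real (n i) + a i * boost_cost_Y)" using m0 P0 by simp
  then have cY: "0 < real (card (Y i))"
    using adm i unfolding admissible_def by (meson less_le_trans)
  then show "Y i \<noteq> {}" by auto
  obtain x where "x \<in> X" using X by auto
  then have "(P + excess (n i) (a i)) * real (card (Y i)) \<le> real (card (nbr i x \<inter> Y i))"
    using adm i by (auto simp: admissible_def)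
  also have "\<dots> \<le> 1 * real (card (Y i))" using fY by (simp add: card_mono)
  finally show *: "P + excess (n i) (a i) \<le> 1" using cY by (metis mult_le_cancel_right_pos)
  then have "excess (n i) (a i) < 1" using P0 by simp
  then show "0 \<le> a i" using decay_diff_le[OF n] by (simp add: excess_def)
  have "exp (2 :: real) \<le> 9"
  proof -
    have "exp (1 :: real) ^ 2 \<le> 3 ^ 2" using exp_le by (intro power_mono) auto
    then show ?thesis using exp_of_nat_mult[of 2 "1::real"] by simp
  qed
  have "exp (2 - L) \<le> exp (2 + (2 - a i - (real t - real (n i)) * decay))"
    using a decay_diff_le[OF n] by simp
  also have "\<dots> = exp 2 * excess (n i) (a i)" unfolding excess_def by (rule exp_add)
  also have "\<dots> \<le> 9 * excess (n i) (a i)"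
    using \<open>exp 2 \<le> 9\<close> by (intro mult_right_mono) (auto simp: excess_def)
  finally show "exp (2 - L) \<le> 9 * excess (n i) (a i)" .
qed

text \<open>Spending \<open>w = ln (1 + u)\<close> multiplies the excess by exactly
  \<open>1 + u\<close>. The rates in \<open>boost_cost_le\<close> cover the shrinking of
  \<open>X\<close> and the factor \<open>P\<close> lost by \<open>Y i\<close>; the bound on
  \<open>w\<close> later gives termination.\<close>

lemma admissible_boost:
  assumes adm: "admissible X Y n a" and i: "i < r" and s: "S \<le> s" and x: "x \<in> X" and X': "X' \<subseteq> X"
    and card: "exp (- 6 * real r * (real s + 1)) * real (card X) \<le> real (card X')"
    and dens: "\<And>y. y \<in> X' \<Longrightarrow> (P + (1 + (real s)\<^sup>2 / (3 * real r * real t)) * excess (n i) (a i))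
      * real (card (nbr i x \<inter> Y i)) \<le> real (card (nbr i y \<inter> (nbr i x \<inter> Y i)))"
  obtains w where "1 \<le> boost_cost_Y * w" "admissible X' (Y(i := nbr i x \<inter> Y i)) n (a(i := a i - w))"
proof -
  define u where "u = (real s)\<^sup>2 / (3 * real r * real t)"
  define Y' where "Y' = nbr i x \<inter> Y i"
  define e where "e = excess (n i) (a i)"
  note bnd = admissible_bounds[OF adm i]
  have u0: "0 \<le> u" by (simp add: u_def)
  have e0: "0 < e" by (simp add: e_def excess_def)
  have fin: "finite Y'" "finite X'" using bnd X' finite_subset by (auto simp: Y'_def)
  have cX: "0 < real (card X)" using bnd by (simp add: card_gt_0_iff)
  have "0 < real (card X')" using card cX by (smt (verit) exp_gt_zero mult_pos_pos)
  then obtain y where y: "y \<in> X'" by fastforce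
  have cY': "(P + e) * real (card (Y i)) \<le> real (card Y')"
    using adm i x by (auto simp: admissible_def e_def Y'_def)
  have cY0: "0 < real (card (Y i))" using bnd by (simp add: card_gt_0_iff)
  have "0 < (P + e) * real (card (Y i))" using cY0 P0 e0 by simp
  then have cY'0: "0 < real (card Y')" using cY' by linarith
  \<comment> \<open>A vertex of \<open>X'\<close> witnesses that the boosted density is at most 1;
    this caps \<open>u\<close>.\<close>
  have "(P + (1 + u) * e) * real (card Y') \<le> real (card (nbr i y \<inter> Y'))"
    using dens[OF y] by (simp add: u_def e_def Y'_def)
  also have "\<dots> \<le> 1 * real (card Y')" using fin by (simp add: card_mono)
  finally have "P + (1 + u) * e \<le> 1" using cY'0 by (metis mult_le_cancel_right_pos)
  then have ue: "u * e \<le> 1" using P0 e0 by (simp add: algebra_simps)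
  have "u * exp (2 - L) \<le> u * (9 * e)" using bnd(7) u0 by (intro mult_left_mono) (auto simp: e_def)
  also have "\<dots> \<le> 9" using ue by simp
  finally have "u * exp (2 - L) \<le> 9" .
  note costs = boost_cost_le[OF s u_def this]
  define w where "w = ln (1 + u)"
  have w0: "0 \<le> w" using u0 by (simp add: w_def)
  have exc: "excess (n i) (a i - w) = (1 + u) * e"
  proof -
    have "excess (n i) (a i - w) = exp (w + (2 - a i - (real t - real (n i)) * decay))"
      by (simp add: excess_def algebra_simps)
    also have "\<dots> = (1 + u) * e" using u0 by (simp add: exp_add w_def e_def excess_def)
    finally show ?thesis .
  qed
  have "admissible X' (Y(i := Y')) n (a(i := a i - w))"
    unfolding admissible_def
  proof (intro conjI allI impI ballI)
    show "X' \<subseteq> V" using adm X' by (auto simp: admissible_def)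
    have "(\<Sum>j<r. real (n j) * colour_cost + (a(i := a i - w)) j * boost_cost_X)
        = (\<Sum>j<r. real (n j) * colour_cost + a j * boost_cost_X) - w * boost_cost_X"
      by (subst sum_fun_upd_lessThan[OF i, where f="\<lambda>j v. real (n j) * colour_cost + v * boost_cost_X"])
        (simp add: algebra_simps)
    also have "\<dots> \<le> - 6 * real r * (real s + 1) + (\<Sum>j<r. real (n j) * colour_cost + a j * boost_cost_X)"
      using costs(1) by (simp add: w_def mult.commute)
    finally have "exp (\<Sum>j<r. real (n j) * colour_cost + (a(i := a i - w)) j * boost_cost_X)
        \<le> exp (- 6 * real r * (real s + 1)) * exp (\<Sum>j<r. real (n j) * colour_cost + a j * boost_cost_X)"
      by (simp flip: exp_add)
    also have "\<dots> \<le> exp (- 6 * real r * (real s + 1)) * real (card X)"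
      using adm by (intro mult_left_mono) (auto simp: admissible_def)
    finally show "exp (\<Sum>j<r. real (n j) * colour_cost + (a(i := a i - w)) j * boost_cost_X) \<le> real (card X')"
      using card by linarith
  next
    fix j assume j: "j < r"
    show "(Y(i := Y')) j \<subseteq> V" "n j \<le> t" "(a(i := a i - w)) j \<le> L"
      using adm i j w0 by (auto simp: admissible_def Y'_def intro: order_trans[of _ "a i"])
    show "m * (1 / P) powr (real (n j) + (a(i := a i - w)) j * boost_cost_Y) \<le> real (card ((Y(i := Y')) j))"
    proof (cases "j = i")
      case True
      have "P \<le> 1" using bnd(5) e0 by (simp add: e_def)
      then have "m * (1 / P) powr (real (n i) + (a i - w) * boost_cost_Y)
          \<le> m * (1 / P) powr (real (n i) + a i * boost_cost_Y - 1)"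
        using m0 P0 costs(2) by (intro mult_left_mono powr_mono) (auto simp: w_def algebra_simps)
      also have "\<dots> = P * (m * (1 / P) powr (real (n i) + a i * boost_cost_Y))"
        using P0 by (simp add: powr_diff)
      also have "\<dots> \<le> P * real (card (Y i))"
        using adm i P0 by (intro mult_left_mono) (auto simp: admissible_def)
      also have "\<dots> \<le> (P + e) * real (card (Y i))" using e0 by (intro mult_right_mono) auto
      finally show ?thesis using cY' True by simp
    qed (use adm j in \<open>auto simp: admissible_def\<close>)
    fix z assume z: "z \<in> X'"
    show "(P + excess (n j) ((a(i := a i - w)) j)) * real (card ((Y(i := Y')) j))
        \<le> real (card (nbr j z \<inter> (Y(i := Y')) j))"
    proof (cases "j = i")
      case True
      then show ?thesis using dens[OF z] by (simp add: exc u_def e_def Y'_def)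
    qed (use adm j z X' in \<open>auto simp: admissible_def\<close>)
  qed
  moreover have "1 \<le> boost_cost_Y * w" using costs(2) by (simp add: w_def)
  ultimately show thesis using that by (simp add: Y'_def)
qed

text \<open>The vertex \<open>x\<close> goes to a colour \<open>j\<close> popular in
  \<open>X'\<close>, known only afterwards, so \<open>dens\<close> covers all colours. Only
  \<open>Y j\<close> shrinks, and the other densities persist. \<open>colour_cost\<close> pays for
  passing to \<open>X'\<close> and then to the neighbourhood.\<close>

lemma admissible_colour:
  assumes adm: "admissible X Y n a" and s: "s < S" and x: "x \<in> X" and X': "X' \<subseteq> X"
    and n1: "\<And>i. i < r \<Longrightarrow> 1 \<le> n i"
    and card: "exp (- 6 * real r * (real s + 1)) * real (card X) \<le> real (card X')"
    and dens: "\<And>y j. y \<in> X' \<Longrightarrow> j < r \<Longrightarrow> (P + (1 - 1 / real t) * excess (n j) (a j))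
      * real (card (nbr j x \<inter> Y j)) \<le> real (card (nbr j y \<inter> (nbr j x \<inter> Y j)))"
  obtains j where "j < r" "admissible (nbr j x \<inter> X') (Y(j := nbr j x \<inter> Y j)) (n(j := n j - 1)) a"
proof -
  define \<Sigma> where "\<Sigma> = (\<Sum>i<r. real (n i) * colour_cost + a i * boost_cost_X)"
  have XV: "X \<subseteq> V" and cX: "exp \<Sigma> \<le> real (card X)" using adm by (auto simp: admissible_def \<Sigma>_def)
  have cc0: "0 \<le> colour_cost"
    using r1 by (auto simp: colour_cost_def intro!: add_nonneg_nonneg)
  have bX0: "0 \<le> boost_cost_X" by (simp add: boost_cost_X_def)
  have term_ge: "colour_cost \<le> real (n i) * colour_cost + a i * boost_cost_X" if "i < r" for i
  proof -
    have "1 * colour_cost \<le> real (n i) * colour_cost" using n1[OF that] cc0 by (intro mult_right_mono) auto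
    moreover have "0 \<le> a i * boost_cost_X" using admissible_bounds(6)[OF adm that] bX0 by simp
    ultimately show ?thesis by simp
  qed
  have "colour_cost \<le> real (n 0) * colour_cost + a 0 * boost_cost_X" using term_ge r1 by simp
  also have "\<dots> \<le> \<Sigma>"
    unfolding \<Sigma>_def using r1 term_ge cc0
    by (intro member_le_sum) (auto intro: order_trans)
  finally have \<Sigma>: "colour_cost \<le> \<Sigma>" .
  have "exp (\<Sigma> - 6 * real r * real S) \<le> exp (- 6 * real r * (real s + 1)) * exp \<Sigma>"
  proof -
    have "6 * real r * (real s + 1) \<le> 6 * real r * real S" using s by (intro mult_left_mono) auto
    then show ?thesis by (simp flip: exp_add)
  qed
  also have "\<dots> \<le> exp (- 6 * real r * (real s + 1)) * real (card X)"
    using cX by (intro mult_left_mono) auto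
  finally have cX': "exp (\<Sigma> - 6 * real r * real S) \<le> real (card X')" using card by linarith
  \<comment> \<open>The reserve for one missing vertex leaves \<open>X'\<close> with at least two
    elements, as \<open>ex_large_nbr\<close> requires.\<close>
  have "ln 2 \<le> ln (2 * real r)" using r1 by simp
  then have "exp (ln 2) \<le> exp (\<Sigma> - 6 * real r * real S)"
    using \<Sigma> unfolding exp_le_cancel_iff colour_cost_def by linarith
  then have "2 \<le> card X'" using cX' by simp
  then obtain j where j: "j < r" "real (card X') \<le> 2 * real r * real (card (nbr j x \<inter> X'))"
    using ex_large_nbr[of x X'] x X' XV by blast
  define X'' where "X'' = nbr j x \<inter> X'"
  define Y' where "Y' = nbr j x \<inter> Y j"
  note bnd = admissible_bounds[OF adm j(1)]
  have e0: "0 < excess (n i) (a i)" for i by (simp add: excess_def)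
  have exc: "excess (n j - 1) (a j) = (1 - 1 / real t) * excess (n j) (a j)"
  proof -
    have "excess (n j - 1) (a j) = exp (- decay + (2 - a j - (real t - real (n j)) * decay))"
      using n1[OF j(1)] by (simp add: excess_def of_nat_diff algebra_simps)
    also have "\<dots> = exp (- decay) * excess (n j) (a j)" unfolding excess_def by (rule exp_add)
    finally show ?thesis by (simp add: exp_decay)
  qed
  have cY': "(P + excess (n j) (a j)) * real (card (Y j)) \<le> real (card Y')"
    using adm j(1) x by (auto simp: admissible_def Y'_def)
  have "admissible X'' (Y(j := Y')) (n(j := n j - 1)) a"
    unfolding admissible_def
  proof (intro conjI allI impI ballI)
    show "X'' \<subseteq> V" using X' XV by (auto simp: X''_def)
    have "(\<Sum>i<r. real ((n(j := n j - 1)) i) * colour_cost + a i * boost_cost_X) = \<Sigma> - colour_cost"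
      using n1[OF j(1)]
      by (subst sum_fun_upd_lessThan[OF j(1), where f="\<lambda>i v. real v * colour_cost + a i * boost_cost_X"])
        (simp add: \<Sigma>_def of_nat_diff algebra_simps)
    then have "exp (\<Sum>i<r. real ((n(j := n j - 1)) i) * colour_cost + a i * boost_cost_X)
        = exp (\<Sigma> - 6 * real r * real S) / (2 * real r)"
      using r1 by (simp add: colour_cost_def diff_diff_eq[symmetric] exp_diff)
    also have "\<dots> \<le> real (card X') / (2 * real r)"
      using cX' by (intro divide_right_mono) auto
    also have "\<dots> \<le> real (card X'')" using j(2) r1 by (simp add: X''_def divide_le_eq mult_ac)
    finally show "exp (\<Sum>i<r. real ((n(j := n j - 1)) i) * colour_cost + a i * boost_cost_X) \<le> real (card X'')" .
  next
    fix i assume i: "i < r"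
    show "(Y(j := Y')) i \<subseteq> V" "(n(j := n j - 1)) i \<le> t" "a i \<le> L"
      using adm i j(1) by (auto simp: admissible_def Y'_def le_diff_conv intro: trans_le_add1)
    show "m * (1 / P) powr (real ((n(j := n j - 1)) i) + a i * boost_cost_Y) \<le> real (card ((Y(j := Y')) i))"
    proof (cases "i = j")
      case True
      have "m * (1 / P) powr (real (n j - 1) + a j * boost_cost_Y)
          = m * (1 / P) powr (real (n j) + a j * boost_cost_Y - 1)"
        using n1[OF j(1)] by (simp add: of_nat_diff algebra_simps)
      also have "\<dots> = P * (m * (1 / P) powr (real (n j) + a j * boost_cost_Y))"
        using P0 by (simp add: powr_diff)
      also have "\<dots> \<le> P * real (card (Y j))"
        using adm j P0 by (intro mult_left_mono) (auto simp: admissible_def)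
      also have "\<dots> \<le> (P + excess (n j) (a j)) * real (card (Y j))"
        using e0[of j] by (intro mult_right_mono) auto
      finally show ?thesis using cY' True by simp
    qed (use adm i in \<open>auto simp: admissible_def\<close>)
    fix z assume z: "z \<in> X''"
    show "(P + excess ((n(j := n j - 1)) i) (a i)) * real (card ((Y(j := Y')) i))
        \<le> real (card (nbr i z \<inter> (Y(j := Y')) i))"
    proof (cases "i = j")
      case True
      then show ?thesis using dens[of z j] z i exc by (simp add: X''_def Y'_def)
    qed (use adm i z X' in \<open>auto simp: admissible_def X''_def\<close>)
  qed
  then show thesis using that j(1) by (simp add: X''_def Y'_def)
qed

text \<open>The sum is a potential that a colour step lowers by 1 and a boost by at least 1. The run
  ends when some colour is complete. On the way back the vertices of the colour steps join the
  spine, so the claim concerns the \<open>n i\<close> vertices still missing.\<close>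

lemma admissible_imp_book:
  assumes "admissible X Y n a" "(\<Sum>i<r. real (n i) + a i * boost_cost_Y) < real b"
  shows "\<exists>i<r. has_book i X (Y i) (n i) m"
  using assms
proof (induction b arbitrary: X Y n a)
  case 0
  have "0 \<le> boost_cost_Y" by (simp add: boost_cost_Y_def)
  then have "0 \<le> (\<Sum>i<r. real (n i) + a i * boost_cost_Y)"
    using admissible_bounds(6)[OF 0(1)] by (intro sum_nonneg add_nonneg_nonneg mult_nonneg_nonneg) auto
  then show ?case using 0(2) by simp
next
  case (Suc b)
  note adm = Suc.prems(1)
  note bnd = admissible_bounds[OF adm]
  have r0: "0 < r" using r1 by simp
  show ?case
  proof (cases "\<exists>i<r. n i = 0")
    case True
    then obtain i where i: "i < r" "n i = 0" by blast
    have "P \<le> 1" using bnd(5)[OF i(1)] by (smt (verit) excess_def exp_gt_zero)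
    then have "1 \<le> (1 / P) powr (a i * boost_cost_Y)"
      using P0 bnd(6)[OF i(1)] by (intro ge_one_powr_ge_zero) (auto simp: boost_cost_Y_def)
    then have "m * 1 \<le> m * (1 / P) powr (a i * boost_cost_Y)" using m0 by (intro mult_left_mono) auto
    also have "\<dots> \<le> real (card (Y i))" using adm i by (auto simp: admissible_def)
    finally show ?thesis using i has_book_0 by auto
  next
    case False
    then have n1: "1 \<le> n i" if "i < r" for i using that by (simp add: Suc_le_eq)
    define e where "e i = excess (n i) (a i)" for i
    have e0: "0 < e i" for i by (simp add: e_def excess_def)
    have rt: "0 < 3 * real r * real t" using r1 t2 by simp
    \<comment> \<open>With scale \<open>e j / (3 * r * t)\<close> the loss is
      \<open>e j / t\<close>, exactly one step of decay, and the gain at level \<open>s\<close> is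
      \<open>e i\<close> times the \<open>u\<close> of a boost.\<close>
    obtain x X' i s where step: "x \<in> X" "X' \<subseteq> X" "i < r"
      "exp (- 6 * real r * (real s + 1)) * real (card X) \<le> real (card X')"
      and all: "\<And>y j. y \<in> X' \<Longrightarrow> j < r \<Longrightarrow> (P + e j - 3 * real r * (e j / (3 * real r * real t)))
        * real (card (nbr j x \<inter> Y j)) \<le> real (card (nbr j y \<inter> (nbr j x \<inter> Y j)))"
      and boost: "\<And>y. y \<in> X' \<Longrightarrow> 0 < s \<Longrightarrow> (P + e i + (real s)\<^sup>2 * (e i / (3 * real r * real t)))
        * real (card (nbr i x \<inter> Y i)) \<le> real (card (nbr i y \<inter> (nbr i x \<inter> Y i)))"
    proof (rule density_step[of X r Y "\<lambda>j. P + e j" "\<lambda>j. e j / (3 * real r * real t)" nbr])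
      show "finite X" "X \<noteq> {}" "1 \<le> r" using bnd[OF r0] r1 by auto
      show "finite (Y i) \<and> Y i \<noteq> {}" "0 < P + e i" "0 < e i / (3 * real r * real t)" if "i < r" for i
        using bnd[OF that] P0 e0[of i] rt by (auto intro: add_pos_pos)
      show "(P + e i) * real (card (Y i)) \<le> real (card (nbr i x \<inter> Y i))" if "i < r" "x \<in> X" for i x
        using adm that by (auto simp: admissible_def e_def)
    qed blast
    show ?thesis
    proof (cases "S \<le> s")
      case True
      have "(P + (1 + (real s)\<^sup>2 / (3 * real r * real t)) * excess (n i) (a i))
        * real (card (nbr i x \<inter> Y i)) \<le> real (card (nbr i y \<inter> (nbr i x \<inter> Y i)))" if "y \<in> X'" for y
      proof -
        have eq: "P + (1 + (real s)\<^sup>2 / (3 * real r * real t)) * e i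
            = P + e i + (real s)\<^sup>2 * (e i / (3 * real r * real t))"
          by (simp add: algebra_simps)
        have "0 < s" using True S1 by simp
        from boost[OF that this] show ?thesis unfolding e_def[symmetric] eq .
      qed
      from admissible_boost[OF adm step(3) True step(1,2,4) this]
      obtain w where w: "1 \<le> boost_cost_Y * w"
        and adm': "admissible X' (Y(i := nbr i x \<inter> Y i)) n (a(i := a i - w))" by blast
      have "(\<Sum>j<r. real (n j) + (a(i := a i - w)) j * boost_cost_Y)
          = (\<Sum>j<r. real (n j) + a j * boost_cost_Y) - w * boost_cost_Y"
        by (subst sum_fun_upd_lessThan[OF step(3), where f="\<lambda>j v. real (n j) + v * boost_cost_Y"])
          (simp add: algebra_simps)
      also have "\<dots> < real b" using Suc.prems(2) w by (simp add: mult.commute)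
      finally obtain j where j: "j < r" "has_book j X' ((Y(i := nbr i x \<inter> Y i)) j) (n j) m"
        using Suc.IH[OF adm'] by blast
      have "has_book j X (Y j) (n j) m"
        by (rule has_book_mono[OF j(2) step(2)]) auto
      then show ?thesis using j(1) by blast
    next
      case False
      have "(P + (1 - 1 / real t) * excess (n j) (a j))
        * real (card (nbr j x \<inter> Y j)) \<le> real (card (nbr j y \<inter> (nbr j x \<inter> Y j)))" if "y \<in> X'" "j < r" for y j
      proof -
        have eq: "P + (1 - 1 / real t) * e j = P + e j - 3 * real r * (e j / (3 * real r * real t))"
          using r1 t2 by (simp add: algebra_simps)
        from all[OF that] show ?thesis unfolding e_def[symmetric] eq .
      qed
      from admissible_colour[OF adm _ step(1,2) n1 step(4) this] False
      obtain j where j: "j < r"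
        and adm': "admissible (nbr j x \<inter> X') (Y(j := nbr j x \<inter> Y j)) (n(j := n j - 1)) a" by auto
      have "(\<Sum>i<r. real ((n(j := n j - 1)) i) + a i * boost_cost_Y)
          = (\<Sum>i<r. real (n i) + a i * boost_cost_Y) - 1"
        using n1[OF j]
        by (subst sum_fun_upd_lessThan[OF j, where f="\<lambda>i v. real v + a i * boost_cost_Y"])
          (simp add: of_nat_diff)
      also have "\<dots> < real b" using Suc.prems(2) by simp
      finally obtain i where i: "i < r"
        "has_book i (nbr j x \<inter> X') ((Y(j := nbr j x \<inter> Y j)) i) ((n(j := n j - 1)) i) m"
        using Suc.IH[OF adm'] by blast
      have "has_book i X (Y i) (n i) m"
      proof (cases "i = j")
        case True
        then have "has_book j (nbr j x \<inter> X') (nbr j x \<inter> Y j) (n j - 1) m" using i(2) by simp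
        then have "has_book j X (Y j) (Suc (n j - 1)) m"
          using step(1,2) bnd(1)[OF r0] by (intro has_book_Suc[of j "nbr j x \<inter> X'" "nbr j x \<inter> Y j"]) auto
        then show ?thesis using n1[OF j] True by simp
      next
        case False
        then show ?thesis using i(2) step(2) by (auto intro: has_book_mono)
      qed
      then show ?thesis using i(1) by blast
    qed
  qed
qed

text \<open>The run starts with every \<open>Y i\<close> equal to \<open>U\<close>, empty spines and
  full budgets, where the excess is \<open>exp (2 - L)\<close>.\<close>

lemma exists_book:
  assumes U: "U \<subseteq> V"
    and deg: "\<And>i x. i < r \<Longrightarrow> x \<in> U \<Longrightarrow> (P + exp (2 - L)) * real (card U) \<le> real (card (nbr i x \<inter> U))"
    and "exp (real r * (real t * colour_cost + L * boost_cost_X)) \<le> real (card U)"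
    and "m * (1 / P) powr (real t + L * boost_cost_Y) \<le> real (card U)"
  shows "\<exists>i<r. has_book i U U t m"
proof -
  obtain b where "(\<Sum>i<r. real t + L * boost_cost_Y) < real b"
    using reals_Archimedean2 by blast
  moreover have "admissible U (\<lambda>_. U) (\<lambda>_. t) (\<lambda>_. L)"
    using assms by (simp add: admissible_def excess_def)
  ultimately show ?thesis using admissible_imp_book by blast
qed

end

section \<open>From books to cliques\<close>

lemma prod_fun_upd_lessThan:
  fixes f :: "nat \<Rightarrow> 'b \<Rightarrow> 'c :: field"
  assumes "i < r" "f i (g i) \<noteq> 0"
  shows "(\<Prod>j<r. f j ((g(i := v)) j)) = (\<Prod>j<r. f j (g j)) * (f i v / f i (g i))"
proof -
  have "(\<Prod>j\<in>{..<r} - {i}. f j ((g(i := v)) j)) = (\<Prod>j\<in>{..<r} - {i}. f j (g j))"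
    by (intro prod.cong) auto
  then show ?thesis
    using assms by (simp add: prod.remove[of "{..<r}" i])
qed

context edge_coloring
begin

definition has_clique :: "'a set \<Rightarrow> (nat \<Rightarrow> nat) \<Rightarrow> bool"
  where "has_clique U \<kappa> \<longleftrightarrow> (\<exists>i<r. \<exists>H\<subseteq>U. card H = \<kappa> i \<and> clique i H)"

lemma has_clique_0: "i < r \<Longrightarrow> \<kappa> i = 0 \<Longrightarrow> has_clique U \<kappa>"
  unfolding has_clique_def by (intro exI[of _ i] conjI exI[of _ "{}"]) (auto simp: clique_def)

text \<open>A clique of colour \<open>i\<close> in \<open>Z\<close> grows by the whole of
  \<open>T\<close>; every other colour keeps its target and its clique.\<close>

lemma has_clique_extend:
  assumes Z: "has_clique Z (\<kappa>(i := \<kappa> i - card T))" "card T \<le> \<kappa> i"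
    and U: "U \<subseteq> V" "T \<subseteq> U" "Z \<subseteq> U" and T: "clique i T" "\<And>x. x \<in> T \<Longrightarrow> Z \<subseteq> nbr i x"
  shows "has_clique U \<kappa>"
proof -
  obtain j H where H: "j < r" "H \<subseteq> Z" "card H = (\<kappa>(i := \<kappa> i - card T)) j" "clique j H"
    using Z(1) by (auto simp: has_clique_def)
  show ?thesis
  proof (cases "j = i")
    case True
    have fin: "finite T" "finite H"
      using U H(2) finV by (meson finite_subset order_trans)+
    have "T \<inter> H = {}" using T(2) H(2) by (auto simp: nbr_def)
    then have "card (T \<union> H) = \<kappa> i"
      using fin H(3) Z(2) True by (simp add: card_Un_disjoint)
    moreover have "clique i (T \<union> H)"
    proof -
      have TH: "c {x, y} = i" if "x \<in> T" "y \<in> H" for x y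
        using T(2)[OF that(1)] that(2) H(2) by (auto simp: nbr_def)
      have "c {x, y} = i" if "x \<in> H" "y \<in> T" for x y
        using TH[OF that(2,1)] by (simp add: insert_commute)
      with TH show ?thesis using T(1) H(4) True by (auto simp: clique_def)
    qed
    ultimately show ?thesis
      unfolding has_clique_def using H(1,2) True U by (intro exI[of _ i] conjI exI[of _ "T \<union> H"]) auto
  next
    case False
    then show ?thesis
      unfolding has_clique_def using H U by (intro exI[of _ j] conjI exI[of _ H]) auto
  qed
qed

lemma has_clique_nbr:
  assumes "has_clique (nbr i x \<inter> U) (\<kappa>(i := \<kappa> i - 1))" "1 \<le> \<kappa> i" "U \<subseteq> V" "x \<in> U"
  shows "has_clique U \<kappa>"
  using assms by (intro has_clique_extend[of "nbr i x \<inter> U" \<kappa> i "{x}" U]) (auto simp: clique_def)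

text \<open>Passing to the neighbourhood of a vertex in colour \<open>i\<close> multiplies the
  product by \<open>w i\<close>. As the weights sum to at most 1, some neighbourhood is large enough
  for induction. Uniform weights give powers of \<open>r\<close>; others suit unequal
  targets.\<close>

lemma erdos_szekeres_weighted:
  assumes r: "2 \<le> r" and w: "\<And>i. i < r \<Longrightarrow> 0 < w i" "(\<Sum>i<r. w i) \<le> 1"
    and "U \<subseteq> V" "(\<Prod>i<r. (1 / w i) ^ \<kappa> i) \<le> real (card U) + 1"
  shows "has_clique U \<kappa>"
  using assms(4,5)
proof (induction "card U" arbitrary: U \<kappa> rule: less_induct)
  case less
  define W where "W = (\<Prod>i<r. (1 / w i) ^ \<kappa> i)"
  show ?case
  proof (cases "\<exists>i<r. \<kappa> i = 0")
    case True
    then show ?thesis using has_clique_0 by blast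
  next
    case False
    then have \<kappa>: "1 \<le> \<kappa> i" if "i < r" for i using that by (simp add: Suc_le_eq)
    have fin: "finite U" using less.prems(1) finV finite_subset by blast
    have w1: "w i < 1" if "i < r" for i
    proof -
      have "0 < (\<Sum>j\<in>{..<r} - {i}. w j)"
      proof (rule sum_pos)
        \<comment> \<open>A colour different from \<open>i\<close>.\<close>
        have "(if i = 0 then 1 else 0) \<in> {..<r} - {i}" using r by auto
        then show "{..<r} - {i} \<noteq> {}" by blast
      qed (use w in auto)
      then show ?thesis using w(2) that by (simp add: sum.remove[of "{..<r}" i])
    qed
    have "1 < W" unfolding W_def
    proof (rule less_1_prod)
      show "{..<r} \<noteq> {}" using r by (auto simp: lessThan_empty_iff)
      show "1 < (1 / w i) ^ \<kappa> i" if "i \<in> {..<r}" for i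
        using that w(1)[of i] w1[of i] \<kappa>[of i] by (intro one_less_power) auto
    qed auto
    then obtain x where x: "x \<in> U"
      using less.prems(2) by (cases "U = {}") (auto simp: W_def)
    \<comment> \<open>If all colours failed, summation would give
      \<open>card U - 1 + r < card U + 1\<close>, false for \<open>2 <= r\<close>. The added 1
      absorbs the loss of \<open>x\<close>.\<close>
    have "\<exists>i<r. W * w i \<le> real (card (nbr i x \<inter> U)) + 1"
    proof (rule ccontr)
      assume "\<not> ?thesis"
      then have "(\<Sum>i<r. real (card (nbr i x \<inter> U)) + 1) < (\<Sum>i<r. W * w i)"
        using r by (intro sum_strict_mono) (auto simp: not_le lessThan_empty_iff)
      also have "\<dots> = W * (\<Sum>i<r. w i)" by (simp add: sum_distrib_left)
      also have "\<dots> \<le> W * 1" using w(2) \<open>1 < W\<close> by (intro mult_left_mono) auto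
      also have "\<dots> \<le> real (card U) + 1" using less.prems(2) by (simp add: W_def)
      also have "(\<Sum>i<r. real (card (nbr i x \<inter> U)) + 1) = real (card (U - {x})) + real r"
        using sum_card_nbr[of x U] x less.prems(1) by (auto simp: sum.distrib simp flip: of_nat_sum)
      also have "real (card (U - {x})) = real (card U) - 1"
      proof -
        have "card U = Suc (card (U - {x}))" using card.remove[OF fin x] .
        then show ?thesis by simp
      qed
      finally show False using r by simp
    qed
    then obtain i where i: "i < r" "W * w i \<le> real (card (nbr i x \<inter> U)) + 1" by blast
    have "(\<Prod>j<r. (1 / w j) ^ (\<kappa>(i := \<kappa> i - 1)) j) = W * ((1 / w i) ^ (\<kappa> i - 1) / (1 / w i) ^ \<kappa> i)"
      unfolding W_def using i(1) w(1)[OF i(1)]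
      by (subst prod_fun_upd_lessThan[where f="\<lambda>j v. (1 / w j) ^ v"]) auto
    also have "(1 / w i) ^ (\<kappa> i - 1) / (1 / w i) ^ \<kappa> i = w i"
      using w(1)[OF i(1)] \<kappa>[OF i(1)] by (cases "\<kappa> i") auto
    finally have W': "(\<Prod>j<r. (1 / w j) ^ (\<kappa>(i := \<kappa> i - 1)) j) \<le> real (card (nbr i x \<inter> U)) + 1"
      using i(2) by simp
    have "nbr i x \<inter> U \<subset> U" using x by (auto simp: nbr_def)
    then have "card (nbr i x \<inter> U) < card U" using fin by (rule psubset_card_mono[rotated])
    from less.hyps[OF this _ W'] less.prems(1)
    have "has_clique (nbr i x \<inter> U) (\<kappa>(i := \<kappa> i - 1))" by blast
    then show ?thesis using \<kappa>[OF i(1)] less.prems(1) x by (rule has_clique_nbr)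
  qed
qed

text \<open>While some vertex has too large a degree in a colour, pass to that neighbourhood and
  lower the target of the colour by one; \<open>a i\<close> counts these passages.\<close>

lemma regular_subset:
  assumes \<epsilon>: "0 \<le> \<epsilon>" and "\<not> has_clique V (\<lambda>_. k)"
  obtains U a where "U \<subseteq> V" "\<not> has_clique U (\<lambda>i. k - a i)"
    "((1 + \<epsilon>) / real r) ^ (\<Sum>i<r. a i) * real (card V) \<le> real (card U)"
    "\<And>x i. x \<in> U \<Longrightarrow> i < r \<Longrightarrow> real (card (nbr i x \<inter> U)) \<le> (1 + \<epsilon>) / real r * real (card U)"
proof -
  define reach where "reach p \<longleftrightarrow> fst p \<subseteq> V \<and> \<not> has_clique (fst p) (\<lambda>i. k - snd p i)
    \<and> ((1 + \<epsilon>) / real r) ^ (\<Sum>i<r. snd p i) * real (card V) \<le> real (card (fst p))"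
    for p :: "'a set \<times> (nat \<Rightarrow> nat)"
  have "reach (V, \<lambda>_. 0)" using assms by (simp add: reach_def)
  \<comment> \<open>A reachable pair with fewest vertices replaces the iteration, since a further
    passage would be reachable and strictly smaller.\<close>
  from ex_has_least_nat[of reach, OF this, of "\<lambda>p. card (fst p)"]
  obtain p where p: "reach p" "\<forall>q. reach q \<longrightarrow> card (fst p) \<le> card (fst q)" by blast
  obtain U a where [simp]: "p = (U, a)" by fastforce
  have U: "U \<subseteq> V" "\<not> has_clique U (\<lambda>i. k - a i)"
    "((1 + \<epsilon>) / real r) ^ (\<Sum>i<r. a i) * real (card V) \<le> real (card U)"
    using p(1) by (auto simp: reach_def)
  show thesis
  proof (rule that[OF U])
    fix x i assume x: "x \<in> U" and i: "i < r"
    show "real (card (nbr i x \<inter> U)) \<le> (1 + \<epsilon>) / real r * real (card U)"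
    proof (rule ccontr)
      assume neg: "\<not> ?thesis"
      \<comment> \<open>A target 0 would be met by the empty clique, so the subtraction is never
        truncated here.\<close>
      have "1 \<le> k - a i" using has_clique_0[OF i, of "\<lambda>i. k - a i"] U(2) by fastforce
      moreover have "(\<lambda>j. k - (a(i := a i + 1)) j) = (\<lambda>j. k - a j)(i := k - a i - 1)" by auto
      ultimately have nc: "\<not> has_clique (nbr i x \<inter> U) (\<lambda>j. k - (a(i := a i + 1)) j)"
        using U(1,2) x has_clique_nbr[of i x U "\<lambda>j. k - a j"] by auto
      have "(\<Sum>j<r. (a(i := a i + 1)) j) = (\<Sum>j<r. a j) + 1"
      proof -
        have "(\<Sum>j\<in>{..<r} - {i}. (a(i := a i + 1)) j) = (\<Sum>j\<in>{..<r} - {i}. a j)"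
          by (intro sum.cong) auto
        then show ?thesis using i by (simp add: sum.remove[of "{..<r}" i])
      qed
      then have "((1 + \<epsilon>) / real r) ^ (\<Sum>j<r. (a(i := a i + 1)) j) * real (card V)
          = (1 + \<epsilon>) / real r * (((1 + \<epsilon>) / real r) ^ (\<Sum>j<r. a j) * real (card V))"
        by simp
      also have "\<dots> \<le> (1 + \<epsilon>) / real r * real (card U)"
        using U(3) \<epsilon> by (intro mult_left_mono) auto
      also have "\<dots> \<le> real (card (nbr i x \<inter> U))" using neg by simp
      finally have "reach (nbr i x \<inter> U, a(i := a i + 1))"
        using U(1) nc by (auto simp: reach_def)
      then have "card U \<le> card (nbr i x \<inter> U)" using p(2) by fastforce
      moreover have "nbr i x \<inter> U \<subset> U" using x by (auto simp: nbr_def)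
      moreover have "finite U" using U(1) finV finite_subset by blast
      ultimately show False using psubset_card_mono by (metis not_le)
    qed
  qed
qed

text \<open>The degrees of \<open>x\<close> add up to \<open>card U - 1\<close>, and all but one are
  bounded above. The spare term \<open>\<epsilon> * card U / r\<close> pays for the missing
  1.\<close>

lemma min_degree_of_max_degree:
  assumes U: "U \<subseteq> V" "x \<in> U" and i: "i < r"
    and up: "\<And>i. i < r \<Longrightarrow> real (card (nbr i x \<inter> U)) \<le> (1 + \<epsilon>) / real r * real (card U)"
    and big: "real r \<le> \<epsilon> * real (card U)"
  shows "(1 / real r - \<epsilon>) * real (card U) \<le> real (card (nbr i x \<inter> U))"
proof -
  have r0: "0 < real r" using i by simp
  have "finite U" using U(1) finV finite_subset by blast
  then have "card U = Suc (card (U - {x}))" using card.remove U(2) by metis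
  then have "real (card U) - 1 = (\<Sum>j<r. real (card (nbr j x \<inter> U)))"
    using sum_card_nbr[of x U] U by (auto simp flip: of_nat_sum)
  also have "\<dots> = real (card (nbr i x \<inter> U)) + (\<Sum>j\<in>{..<r} - {i}. real (card (nbr j x \<inter> U)))"
    using i by (simp add: sum.remove[of "{..<r}" i])
  also have "(\<Sum>j\<in>{..<r} - {i}. real (card (nbr j x \<inter> U))) \<le> (\<Sum>j\<in>{..<r} - {i}. (1 + \<epsilon>) / real r * real (card U))"
    using up by (intro sum_mono) auto
  also have "\<dots> = (real r - 1) * ((1 + \<epsilon>) / real r * real (card U))"
    using i by (simp add: of_nat_diff)
  finally have "real (card U) - 1 - (real r - 1) * ((1 + \<epsilon>) / real r * real (card U)) \<le> real (card (nbr i x \<inter> U))"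
    by simp
  moreover have "(real r - 1) * ((1 + \<epsilon>) / real r * real (card U))
      = real (card U) + \<epsilon> * real (card U) - real (card U) / real r - \<epsilon> * real (card U) / real r"
    using r0 by (simp add: field_simps)
  moreover have "1 \<le> \<epsilon> * real (card U) / real r" using big r0 by (simp add: le_divide_eq)
  ultimately show ?thesis by (simp add: algebra_simps)
qed

end

section \<open>Tilted weights, and the existence of a clique under conditions on the
  parameters\<close>

lemma ln_one_minus_ge:
  fixes z :: real
  assumes "0 \<le> z" "z \<le> 1 / 2"
  shows "- (2 * z) \<le> ln (1 - z)"
proof -
  have "2 * z\<^sup>2 \<le> z" using assms mult_left_mono[of z "1/2" z] by (simp add: power2_eq_square)
  then show ?thesis using ln_one_minus_pos_lower_bound[OF assms] by linarith
qed

text \<open>Off the diagonal, tilting the uniform weights towards the other colours gains a factor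
  \<open>exp (- t\<^sup>2 / (32 * k))\<close> over \<open>r ^ (\<Sum>i<r. \<kappa> i - t)\<close>.\<close>

lemma tilted_weights:
  fixes \<kappa> :: "nat \<Rightarrow> nat"
  assumes r: "2 \<le> r" and i: "i < r" and t: "1 \<le> t" "t \<le> k"
    and \<kappa>: "\<And>j. j < r \<Longrightarrow> \<kappa> j \<le> k" "t \<le> \<kappa> i"
    and sum: "(\<Sum>j<r. real (\<kappa> j)) = real r * real k - s" and s: "0 \<le> s" "s \<le> real t / 8"
  obtains w where "\<And>j. j < r \<Longrightarrow> 0 < w j" "(\<Sum>j<r. w j) \<le> 1"
    "(\<Prod>j<r. (1 / w j) ^ (\<kappa>(i := \<kappa> i - t)) j)
      \<le> exp ((real r * real k - s - real t) * ln (real r) - (real t)\<^sup>2 / (32 * real k))"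
proof -
  define K T R where "K = real k" and "T = real t" and "R = real r"
  \<comment> \<open>Colour \<open>i\<close> has the smaller target and gives up weight. The gain
    \<open>T * \<theta>\<close> is \<open>T^2 / (4 * K)\<close>; the errors
    \<open>3 * K * \<theta>^2\<close> and \<open>s * \<theta>\<close> are at most 6/8 and 1/8 of it,
    which leaves \<open>T^2 / (32 * K)\<close>.\<close>
  define \<theta> where "\<theta> = T / (4 * K)"
  define y where "y = \<theta> / (R - 1)"
  define w where "w j = (if j = i then (1 - \<theta>) / R else (1 + y) / R)" for j
  have R: "2 \<le> R" and T: "1 \<le> T" "T \<le> K" and K: "0 < K" using r t by (auto simp: R_def T_def K_def)
  have \<theta>: "0 \<le> \<theta>" "\<theta> \<le> 1 / 4" using T K by (auto simp: \<theta>_def divide_le_eq)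
  have y: "0 \<le> y" "y * (R - 1) = \<theta>" "y \<le> \<theta>"
    using R \<theta> by (auto simp: y_def divide_le_eq mult_left_mono[of 1 "R - 1" \<theta>, simplified])
  have w0: "0 < w j" for j using R \<theta> y by (auto simp: w_def add_pos_nonneg)
  have "(\<Sum>j<r. w j) = w i + (\<Sum>j\<in>{..<r} - {i}. (1 + y) / R)"
    using i by (simp add: sum.remove[of "{..<r}" i] w_def)
  also have "\<dots> = (1 - \<theta>) / R + (R - 1) * ((1 + y) / R)"
    using i by (simp add: w_def R_def of_nat_diff)
  also have "\<dots> = (1 - \<theta> + (R - 1) + y * (R - 1)) / R" using R by (simp add: field_simps)
  also have "\<dots> = 1" using R by (simp add: y(2))
  finally have w1: "(\<Sum>j<r. w j) \<le> 1" by simp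
  define A where "A = (\<Sum>j\<in>{..<r} - {i}. real (\<kappa> j))"
  have sumA: "real (\<kappa> i) + A = R * K - s"
    using sum i by (simp add: A_def R_def K_def sum.remove[of "{..<r}" i])
  have \<kappa>i: "real (\<kappa> i) \<le> K" "T \<le> real (\<kappa> i)" using \<kappa>(1)[OF i] \<kappa>(2) by (auto simp: K_def T_def)
  have lw: "ln (1 / w j) = ln R - ln (R * w j)" for j
    using w0[of j] R by (simp add: ln_div ln_mult)
  have Rw: "R * w i = 1 - \<theta>" "j \<noteq> i \<Longrightarrow> R * w j = 1 + y" for j
    using R by (auto simp: w_def)
  have "ln (\<Prod>j<r. (1 / w j) ^ (\<kappa>(i := \<kappa> i - t)) j) = (\<Sum>j<r. real ((\<kappa>(i := \<kappa> i - t)) j) * ln (1 / w j))"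
    using w0 by (subst ln_prod) (auto simp: ln_realpow less_imp_neq[THEN not_sym])
  also have "\<dots> = real (\<kappa> i - t) * (ln R - ln (1 - \<theta>))
      + (\<Sum>j\<in>{..<r} - {i}. real (\<kappa> j) * (ln R - ln (1 + y)))"
    using i by (simp add: sum.remove[of "{..<r}" i] lw Rw)
  also have "\<dots> = (real (\<kappa> i) - T) * (ln R - ln (1 - \<theta>)) + A * (ln R - ln (1 + y))"
    using \<kappa>(2) by (simp add: A_def T_def of_nat_diff sum_distrib_right)
  also have "\<dots> = (real (\<kappa> i) + A - T) * ln R + (real (\<kappa> i) - T) * (- ln (1 - \<theta>)) + A * (- ln (1 + y))"
    by (simp add: algebra_simps)
  finally have eq: "ln (\<Prod>j<r. (1 / w j) ^ (\<kappa>(i := \<kappa> i - t)) j) = \<dots>" .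
  have b1: "(real (\<kappa> i) - T) * (- ln (1 - \<theta>)) \<le> (K - T) * (\<theta> + 2 * \<theta>\<^sup>2)"
    using ln_one_minus_pos_lower_bound[of \<theta>] \<theta> \<kappa>i by (intro mult_mono) auto
  have b2: "A * (- ln (1 + y)) \<le> ((R - 1) * K - s) * (- (y - y\<^sup>2))"
  proof -
    have y1: "y \<le> 1" using y \<theta> by linarith
    have "0 \<le> y - y\<^sup>2" using y y1 by (simp add: power2_eq_square mult_left_le)
    moreover have "y - y\<^sup>2 \<le> ln (1 + y)" using ln_one_plus_pos_lower_bound[of y] y y1 by simp
    moreover have "0 \<le> A" by (simp add: A_def sum_nonneg)
    moreover have "(R - 1) * K - s \<le> A" using sumA \<kappa>i by (simp add: algebra_simps)
    ultimately have "((R - 1) * K - s) * (y - y\<^sup>2) \<le> A * (y - y\<^sup>2)" "A * (y - y\<^sup>2) \<le> A * ln (1 + y)"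
      by (auto intro: mult_right_mono mult_left_mono)
    then show ?thesis unfolding mult_minus_right by linarith
  qed
  have b3: "(K - T) * (\<theta> + 2 * \<theta>\<^sup>2) + ((R - 1) * K - s) * (- (y - y\<^sup>2))
      \<le> - (T * \<theta>) + 3 * K * \<theta>\<^sup>2 + s * \<theta>"
  proof -
    \<comment> \<open>The first-order terms \<open>K * \<theta>\<close> cancel because
      \<open>y\<close> redistributes exactly the weight taken from colour \<open>i\<close>.\<close>
    have 1: "(R - 1) * K * y = K * \<theta>" using y(2) by (simp add: mult_ac)
    have 2: "(R - 1) * K * y\<^sup>2 \<le> K * \<theta>\<^sup>2"
    proof -
      have "(R - 1) * K * y\<^sup>2 = K * (\<theta> * y)" using y(2) by (simp add: power2_eq_square mult_ac)
      also have "\<dots> \<le> K * (\<theta> * \<theta>)" using K \<theta> y by (intro mult_left_mono) auto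
      finally show ?thesis by (simp add: power2_eq_square)
    qed
    have 3: "s * y \<le> s * \<theta>" "0 \<le> s * y\<^sup>2" "0 \<le> T * (2 * \<theta>\<^sup>2)"
      using s y T by (auto intro: mult_left_mono)
    have "(K - T) * (\<theta> + 2 * \<theta>\<^sup>2) + ((R - 1) * K - s) * (- (y - y\<^sup>2))
        = K * \<theta> + 2 * (K * \<theta>\<^sup>2) - T * \<theta> - T * (2 * \<theta>\<^sup>2) - (R - 1) * K * y + (R - 1) * K * y\<^sup>2 + s * y - s * y\<^sup>2"
      by (simp add: algebra_simps)
    then show ?thesis using 1 2 3 by linarith
  qed
  have b4: "- (T * \<theta>) + 3 * K * \<theta>\<^sup>2 + s * \<theta> \<le> - (T\<^sup>2 / (32 * K))"
  proof -
    have "s * \<theta> \<le> T / 8 * \<theta>" using s \<theta> by (intro mult_right_mono) (auto simp: T_def)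
    moreover have "T * \<theta> = T\<^sup>2 / (4 * K)" "K * \<theta>\<^sup>2 = T\<^sup>2 / (16 * K)"
      using K by (auto simp: \<theta>_def power2_eq_square)
    ultimately show ?thesis by simp
  qed
  have "ln (\<Prod>j<r. (1 / w j) ^ (\<kappa>(i := \<kappa> i - t)) j) \<le> (R * K - s - T) * ln R - T\<^sup>2 / (32 * K)"
    unfolding eq sumA using b1 b2 b3 b4 by linarith
  moreover have "0 < (\<Prod>j<r. (1 / w j) ^ (\<kappa>(i := \<kappa> i - t)) j)"
    using w0 by (intro prod_pos) auto
  ultimately have prod_le: "(\<Prod>j<r. (1 / w j) ^ (\<kappa>(i := \<kappa> i - t)) j) \<le> exp ((R * K - s - T) * ln R - T\<^sup>2 / (32 * K))"
    by (metis exp_le_cancel_iff exp_ln)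
  show thesis
    using prod_le by (intro that[of w, OF w0 w1]) (simp only: R_def K_def T_def)
qed

text \<open>Condition \<open>X\<close> keeps the reservoir nonempty throughout the run. Condition
  \<open>Y\<close> weighs the losses in the pages, from the lowered density floor, the boosts and
  the deficit \<open>\<gamma>\<close>, against the gain of the tilted weights.\<close>

lemma (in edge_coloring) has_clique_of_parameters:
  fixes \<epsilon> \<gamma> :: real and t S k :: nat
  assumes r: "2 \<le> r" and \<epsilon>: "0 < \<epsilon>" "4 * \<epsilon> * real r \<le> 1"
    and t: "2 \<le> t" "2 * t \<le> k" and S: "1 \<le> S" "S\<^sup>2 \<le> 3 * r * t" "3 * (real S)\<^sup>2 \<le> \<epsilon> * real r * real t"
    and \<gamma>: "0 \<le> \<gamma>" "32 * \<gamma> \<le> \<epsilon> * real t" "\<gamma> \<le> real k / 8"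
    and big: "real r \<le> \<epsilon> * (real r * real k / 4)"
    and X: "real r * (real t * (6 * real r * real S + ln (2 * real r))
      + (2 - ln \<epsilon>) * (72 * (real r)\<^sup>2 * real t / real S)) \<le> real r * real k / 4"
    and Y: "4 * \<epsilon> * real r * real t
      + (2 - ln \<epsilon>) * (6 * real r * real t / (real S)\<^sup>2) * (ln (real r) + 4 * \<epsilon> * real r) + \<gamma>
      \<le> (real t)\<^sup>2 / (32 * real k)"
    and V: "V \<noteq> {}" "real r * real k * ln (real r) - \<gamma> \<le> ln (real (card V))"
  shows "has_clique V (\<lambda>_. k)"
proof (rule ccontr)
  assume "\<not> ?thesis"
  then obtain U a where U: "U \<subseteq> V" "\<not> has_clique U (\<lambda>i. k - a i)"
    "((1 + \<epsilon>) / real r) ^ (\<Sum>i<r. a i) * real (card V) \<le> real (card U)"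
    and maxdeg: "\<And>x i. x \<in> U \<Longrightarrow> i < r \<Longrightarrow> real (card (nbr i x \<inter> U)) \<le> (1 + \<epsilon>) / real r * real (card U)"
    using regular_subset[of \<epsilon> k] \<epsilon> by (metis less_imp_le)
  define s where "s = (\<Sum>i<r. a i)"
  define l where "l = ln (real r)"
  have r0: "0 < real r" using r by simp
  have cV: "0 < real (card V)" using V(1) finV by (simp add: card_gt_0_iff)
  have pos: "0 < ((1 + \<epsilon>) / real r) ^ s" using \<epsilon> r0 by simp
  have cU: "0 < real (card U)"
    using U(3) mult_pos_pos[OF pos cV] by (simp add: s_def)
  have a_le: "a i \<le> k" if "i < r" for i
    using has_clique_0[OF that, of "\<lambda>i. k - a i"] U(2) by fastforce
  have sum_\<kappa>: "(\<Sum>i<r. real (k - a i)) = real r * real k - real s"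
    using a_le by (simp add: of_nat_diff sum_subtractf s_def)
  have "\<epsilon> * 1 \<le> \<epsilon> * real r" using \<epsilon> r by (intro mult_left_mono) auto
  then have "\<epsilon> \<le> 1" using \<epsilon> by linarith
  have "ln (((1 + \<epsilon>) / real r) ^ s * real (card V)) \<le> ln (real (card U))"
    using U(3) mult_pos_pos[OF pos cV] by (simp add: s_def)
  also have "ln (((1 + \<epsilon>) / real r) ^ s * real (card V)) = real s * (ln (1 + \<epsilon>) - l) + ln (real (card V))"
    using \<epsilon> r0 cV by (simp add: ln_mult ln_realpow ln_div l_def)
  finally have lnU: "real s * ln (1 + \<epsilon>) + (real r * real k - real s) * l - \<gamma> \<le> ln (real (card U))"
    using V(2) by (simp add: l_def algebra_simps)
  \<comment> \<open>Otherwise the factors \<open>1 + \<epsilon>\<close> of the passages make up for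
    the deficit \<open>\<gamma>\<close>, and uniform weights already give the clique. So there were
    few passages and the targets stay almost diagonal.\<close>
  have s_ln: "real s * ln (1 + \<epsilon>) < \<gamma>"
  proof (rule ccontr)
    assume "\<not> ?thesis"
    then have le: "(real r * real k - real s) * l \<le> ln (real (card U))" using lnU by linarith
    have "(\<Prod>i<r. (1 / (1 / real r)) ^ (k - a i)) = exp ((real r * real k - real s) * l)"
    proof -
      have "(\<Prod>i<r. real r ^ (k - a i)) = (\<Prod>i<r. exp (real (k - a i) * l))"
        using r0 by (simp add: l_def exp_of_nat_mult)
      also have "\<dots> = exp (\<Sum>i<r. real (k - a i) * l)" by (simp add: exp_sum)
      finally show ?thesis by (simp add: sum_\<kappa> flip: sum_distrib_right)
    qed
    also have "\<dots> \<le> real (card U)" using le cU by (metis exp_le_cancel_iff exp_ln)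
    finally have "has_clique U (\<lambda>i. k - a i)"
      using r by (intro erdos_szekeres_weighted[of "\<lambda>_. 1 / real r", OF r _ _ U(1)]) auto
    with U(2) show False by simp
  qed
  have s_le: "real s \<le> real t / 8"
  proof -
    have "real s * (\<epsilon> / 2) \<le> real s * ln (1 + \<epsilon>)"
      using \<epsilon> \<open>\<epsilon> \<le> 1\<close> by (intro mult_left_mono ln_one_plus_ge_half) auto
    then have "32 * (real s * (\<epsilon> / 2)) \<le> \<epsilon> * real t" using s_ln \<gamma>(2) by linarith
    then have "\<epsilon> * (real s * 16) \<le> \<epsilon> * real t" by (simp add: mult_ac)
    then show ?thesis using \<epsilon> by simp
  qed
  have lnU': "(real r * real k - real s) * l - \<gamma> \<le> ln (real (card U))"
  proof -
    have "0 \<le> real s * ln (1 + \<epsilon>)" using \<epsilon> by simp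
    then show ?thesis using lnU by linarith
  qed
  have "ln 2 \<le> l" using r by (simp add: l_def)
  then have l: "1 / 2 \<le> l" using half_le_ln_2 by linarith
  have k2: "2 * real k \<le> real r * real k" using r by (intro mult_right_mono) auto
  have tk: "2 * real t \<le> real k" using t(2) by linarith
  have "real r * real k / 4 \<le> (real r * real k - real s) * (1 / 2) - \<gamma>"
    using s_le tk \<gamma>(3) k2 by (simp add: field_simps)
  also have "\<dots> \<le> (real r * real k - real s) * l - \<gamma>"
    using l s_le tk k2 by (intro diff_right_mono mult_left_mono) auto
  also note lnU'
  finally have "exp (real r * real k / 4) \<le> exp (ln (real (card U)))" by simp
  then have U_big: "exp (real r * real k / 4) \<le> real (card U)" using cU by simp
  have "real r * real k / 4 \<le> real (card U)"
    using U_big exp_ge_add_one_self[of "real r * real k / 4"] by linarith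
  then have "\<epsilon> * (real r * real k / 4) \<le> \<epsilon> * real (card U)" using \<epsilon> by (intro mult_left_mono) auto
  then have U_big': "real r \<le> \<epsilon> * real (card U)" using big by linarith
  \<comment> \<open>The minimum density \<open>1 / r - \<epsilon>\<close> splits into the floor
    \<open>P\<close> and the initial excess \<open>\<epsilon> = exp (2 - L)\<close>. The page count
    \<open>m\<close> is the bound from \<open>tilted_weights\<close>.\<close>
  define P where "P = 1 / real r - 2 * \<epsilon>"
  define L where "L = 2 - ln \<epsilon>"
  define m where "m = exp ((real r * real k - real s - real t) * l - (real t)\<^sup>2 / (32 * real k))"
  have P_eq: "P = (1 - 2 * \<epsilon> * real r) / real r" using r0 by (simp add: P_def field_simps)
  have P0: "0 < P" unfolding P_eq using \<epsilon> r0 by (intro divide_pos_pos) auto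
  have exp_L: "exp (2 - L) = \<epsilon>" using \<epsilon> by (simp add: L_def)
  interpret book_params c V r t S P L m
    using r t S P0 by unfold_locales (auto simp: exp_L m_def)
  have deg: "(P + exp (2 - L)) * real (card U) \<le> real (card (nbr i x \<inter> U))" if "i < r" "x \<in> U" for i x
    using min_degree_of_max_degree[OF U(1) that(2,1) maxdeg[OF that(2)] U_big'] by (simp add: exp_L P_def)
  have sizeX: "exp (real r * (real t * colour_cost + L * boost_cost_X)) \<le> real (card U)"
    using U_big X unfolding colour_cost_def boost_cost_X_def L_def
    by (meson exp_le_cancel_iff order_trans)
  have sizeY: "m * (1 / P) powr (real t + L * boost_cost_Y) \<le> real (card U)"
  proof -
    define z where "z = real t + L * boost_cost_Y"
    have "ln \<epsilon> \<le> 0" using \<epsilon> \<open>\<epsilon> \<le> 1\<close> by simp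
    then have z0: "0 \<le> z" by (simp add: z_def L_def boost_cost_Y_def)
    have "ln (1 / P) = l - ln (1 - 2 * \<epsilon> * real r)"
      using P0 \<epsilon> r0 unfolding P_eq l_def by (simp add: ln_div)
    also have "\<dots> \<le> l + 4 * \<epsilon> * real r"
      using ln_one_minus_ge[of "2 * \<epsilon> * real r"] \<epsilon> by simp
    finally have "z * ln (1 / P) \<le> z * (l + 4 * \<epsilon> * real r)" using z0 by (intro mult_left_mono)
    also have "\<dots> = real t * l + (4 * \<epsilon> * real r * real t + L * boost_cost_Y * (l + 4 * \<epsilon> * real r))"
      by (simp add: z_def algebra_simps)
    also have "\<dots> \<le> real t * l + ((real t)\<^sup>2 / (32 * real k) - \<gamma>)"
      using Y by (simp add: L_def boost_cost_Y_def l_def)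
    finally have "(real r * real k - real s - real t) * l - (real t)\<^sup>2 / (32 * real k) + z * ln (1 / P)
        \<le> (real r * real k - real s) * l - \<gamma>"
      by (simp add: algebra_simps)
    also note lnU'
    finally have "exp ((real r * real k - real s - real t) * l - (real t)\<^sup>2 / (32 * real k) + z * ln (1 / P))
        \<le> exp (ln (real (card U)))" by simp
    then show ?thesis
      using P0 cU by (simp add: exp_add m_def z_def powr_def)
  qed
  obtain i T Z where i: "i < r" and T: "T \<subseteq> U" "card T = t" "clique i T" "Z \<subseteq> U" "m \<le> real (card Z)"
    "\<And>x. x \<in> T \<Longrightarrow> Z \<subseteq> nbr i x"
    using exists_book[OF U(1) deg sizeX sizeY] unfolding has_book_def by blast
  have "a i \<le> s" unfolding s_def using i by (intro member_le_sum) auto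
  then have t_le: "t \<le> k - a i" using s_le tk by linarith
  have t1: "1 \<le> t" "t \<le> k" using t by auto
  obtain w where w: "\<And>j. j < r \<Longrightarrow> 0 < w j" "(\<Sum>j<r. w j) \<le> 1"
    "(\<Prod>j<r. (1 / w j) ^ ((\<lambda>i. k - a i)(i := k - a i - t)) j)
      \<le> exp ((real r * real k - real s - real t) * ln (real r) - (real t)\<^sup>2 / (32 * real k))"
    using tilted_weights[OF r i t1, of "\<lambda>i. k - a i" "real s"] t_le sum_\<kappa> s_le by auto
  have "has_clique Z ((\<lambda>i. k - a i)(i := k - a i - t))"
    using w(3) T(5) T(4) U(1) by (intro erdos_szekeres_weighted[OF r w(1,2)]) (auto simp: m_def l_def)
  then have "has_clique U (\<lambda>i. k - a i)"
    using T t_le U(1) by (intro has_clique_extend[of Z "\<lambda>i. k - a i" i T U]) auto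
  with U(2) show False by simp
qed

section \<open>Explicit parameters and the bound for \<open>ramsey_number\<close>\<close>

lemma ln_le_two_sqrt:
  fixes x :: real
  assumes "1 \<le> x"
  shows "ln x \<le> 2 * sqrt x"
proof -
  have "ln x = 2 * ln (sqrt x)" using assms by (simp add: ln_sqrt)
  also have "\<dots> \<le> 2 * sqrt x"
    using ln_le_minus_one[of "sqrt x"] assms by simp
  finally show ?thesis .
qed

text \<open>The factor 2 in the deficit leaves room for rounding the number of vertices down to an
  integer.\<close>

lemma (in edge_coloring) has_clique_diagonal:
  assumes r: "2 \<le> r" and k: "2 ^ 160 * r ^ 16 \<le> k" and V: "V \<noteq> {}"
    and cV: "real r * real k * ln (real r) - 2 * real k / (2 ^ 160 * real r ^ 12) \<le> ln (real (card V))"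
  shows "has_clique V (\<lambda>_. k)"
proof -
  \<comment> \<open>The \<open>X\<close> side asks for \<open>32 * r * S * t <= k\<close>, so the
    gain \<open>t^2 / (32 * k)\<close> is of order \<open>t / (r * S)\<close>. The boost loss is at
    most of order \<open>r^2 * t / S^2\<close>, which suggests \<open>S\<close> of order
    \<open>r^3\<close>; the density loss \<open>4 * \<epsilon> * r * t\<close> then suggests
    \<open>\<epsilon>\<close> of order \<open>1 / r^5\<close>.\<close>
  define t where "t = k div (2 ^ 36 * r ^ 4)"
  define S where "S = 2 ^ 30 * r ^ 3"
  define R K T where "R = real r" and "K = real k" and "T = real t"
  define \<epsilon> where "\<epsilon> = 1 / (2 ^ 50 * R ^ 5)"
  define \<gamma> where "\<gamma> = 2 * K / (2 ^ 160 * R ^ 12)"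
  \<comment> \<open>Bounding both \<open>2 - ln \<epsilon>\<close> and \<open>ln R\<close> by
    multiples of \<open>sqrt R\<close> costs only one factor \<open>R\<close> in their
    product.\<close>
  define q where "q = sqrt R"
  have R: "2 \<le> R" using r by (simp add: R_def)
  have Rp: "R ^ a \<le> R ^ b" if "a \<le> b" for a b using R that by (intro power_increasing) auto
  have R1: "1 \<le> R ^ a" for a using R by (intro one_le_power) simp
  have R0: "0 < R ^ a" for a using R by simp
  have q: "q * q = R" "1 \<le> q" using R by (auto simp: q_def)
  have qR: "q \<le> R" using q mult_left_mono[of 1 q q] by simp
  have K: "2 ^ 160 * R ^ 16 \<le> K"
    using of_nat_mono[OF k, where 'a=real] by (simp add: R_def K_def)
  have TK: "T * (2 ^ 36 * R ^ 4) \<le> K"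
  proof -
    have "t * (2 ^ 36 * r ^ 4) \<le> k" by (simp add: t_def)
    from of_nat_mono[OF this, where 'a=real] show ?thesis by (simp add: R_def K_def T_def)
  qed
  have KT1: "K \<le> (T + 1) * (2 ^ 36 * R ^ 4)"
  proof -
    have "k \<le> (t + 1) * (2 ^ 36 * r ^ 4)"
      unfolding t_def using dividend_less_times_div[of "2 ^ 36 * r ^ 4" k] r
      by (simp add: algebra_simps)
    from of_nat_mono[OF this, where 'a=real] show ?thesis by (simp add: R_def K_def T_def algebra_simps)
  qed
  have "2 ^ 124 * R ^ 12 * (2 ^ 36 * R ^ 4) \<le> (T + 1) * (2 ^ 36 * R ^ 4)"
    using K KT1 by (simp flip: power_add)
  then have "2 ^ 124 * R ^ 12 \<le> T + 1"
    using R0[of 4] by (metis mult_le_cancel_right_pos mult_pos_pos zero_less_numeral zero_less_power)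
  then have T: "2 ^ 123 * R ^ 12 \<le> T" using R1[of 12] by simp
  then have T1: "2 ^ 123 \<le> T" using R1[of 12] by simp
  then have T0: "0 < T" by (rule less_le_trans[rotated]) simp
  have KT: "K \<le> 2 ^ 37 * R ^ 4 * T"
  proof -
    note KT1
    also have "(T + 1) * (2 ^ 36 * R ^ 4) \<le> (2 * T) * (2 ^ 36 * R ^ 4)"
      using T1 R0[of 4] by (intro mult_right_mono) auto
    also have "\<dots> = 2 ^ 37 * R ^ 4 * T" by simp
    finally show ?thesis .
  qed
  have T_le: "c * R ^ n \<le> T" if "c \<le> 2 ^ 123" "n \<le> 12" for c n
  proof -
    have "c * R ^ n \<le> 2 ^ 123 * R ^ 12" using that R0[of n] Rp[of n 12] by (intro mult_mono) auto
    then show ?thesis using T by linarith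
  qed
  have S: "real S = 2 ^ 30 * R ^ 3" by (simp add: S_def R_def)
  have S2: "(real S)\<^sup>2 = 2 ^ 60 * R ^ 6" unfolding S by (simp add: power_mult_distrib flip: power_mult)
  have \<epsilon>0: "0 < \<epsilon>" using R0[of 5] by (simp add: \<epsilon>_def)
  have \<epsilon>R: "\<epsilon> * R = 1 / (2 ^ 50 * R ^ 4)"
    using R by (simp add: \<epsilon>_def field_simps eval_nat_numeral)
  have L: "2 - ln \<epsilon> \<le> 62 * q" "0 \<le> 2 - ln \<epsilon>"
  proof -
    have "- ln \<epsilon> = 50 * ln 2 + 5 * ln R"
    proof -
      define c :: real where "c = 2 ^ 50"
      have "ln c = 50 * ln 2" unfolding c_def by (subst ln_realpow) auto
      moreover have "0 < c" by (simp add: c_def)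
      ultimately show ?thesis
        using R unfolding \<epsilon>_def c_def[symmetric] by (simp add: ln_div ln_mult ln_realpow)
    qed
    moreover have "ln 2 \<le> (1 :: real)" using ln_2_less_1 by simp
    moreover have "ln R \<le> 2 * q" unfolding q_def using R by (intro ln_le_two_sqrt) simp
    moreover have "0 \<le> ln R" using R by simp
    moreover have "0 \<le> ln (2 :: real)" by simp
    ultimately show "2 - ln \<epsilon> \<le> 62 * q" "0 \<le> 2 - ln \<epsilon>" using q(2) by linarith+
  qed
  have \<gamma>_le: "\<gamma> \<le> T / (2 ^ 122 * R ^ 8)"
  proof -
    have "\<gamma> \<le> 2 * (2 ^ 37 * R ^ 4 * T) / (2 ^ 160 * R ^ 12)"
      unfolding \<gamma>_def using KT R0[of 12] by (intro divide_right_mono mult_left_mono) auto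
    also have "\<dots> = T / (2 ^ 122 * R ^ 8)"
      using R by (simp add: field_simps flip: power_add)
    finally show ?thesis .
  qed
  show ?thesis
  proof (rule has_clique_of_parameters[of \<epsilon> t k S \<gamma>])
    show "2 \<le> r" "0 < \<epsilon>" "V \<noteq> {}" by fact+
    have "4 * (\<epsilon> * R) \<le> 1" unfolding \<epsilon>R using R1[of 4] by (simp add: divide_le_eq)
    then show "4 * \<epsilon> * real r \<le> 1" by (simp add: R_def)
    show "2 \<le> t" using T1 by (simp add: T_def)
    have "2 * T \<le> T * (2 ^ 36 * R ^ 4)" using T0 R1[of 4] by simp
    then have "2 * T \<le> K" using TK by linarith
    then show "2 * t \<le> k" by (simp add: T_def K_def)
    show "1 \<le> S" using r by (simp add: S_def Suc_le_eq)
    have "2 ^ 60 * R ^ 6 \<le> T * 1" using T_le[of "2 ^ 60" 6] by simp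
    also have "T * 1 \<le> T * (3 * R)" using R T0 by (intro mult_left_mono) auto
    finally have "real (S\<^sup>2) \<le> real (3 * r * t)" using S2 by (simp add: R_def T_def mult_ac)
    then show "S\<^sup>2 \<le> 3 * r * t" by (simp only: of_nat_le_iff)
    have "3 * (2 ^ 60 * R ^ 6) * (2 ^ 50 * R ^ 4) = 3 * 2 ^ 110 * R ^ 10"
      by (simp flip: power_add)
    also have "\<dots> \<le> T" by (rule T_le) auto
    finally have "3 * (real S)\<^sup>2 \<le> \<epsilon> * R * T"
      unfolding S2 \<epsilon>R using R0[of 4] by (simp add: pos_le_divide_eq)
    then show "3 * (real S)\<^sup>2 \<le> \<epsilon> * real r * real t" by (simp add: R_def T_def)
    show "0 \<le> \<gamma>" using R0[of 12] by (simp add: \<gamma>_def K_def)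
    have "32 * \<gamma> \<le> 32 * (T / (2 ^ 122 * R ^ 8))" using \<gamma>_le by simp
    also have "\<dots> = T * (1 / (2 ^ 117 * R ^ 8))" by simp
    also have "\<dots> \<le> T * (1 / (2 ^ 50 * R ^ 5))"
      using T0 Rp[of 5 8] R0[of 5] R0[of 8]
      by (intro mult_left_mono divide_left_mono mult_mono mult_pos_pos) auto
    finally show "32 * \<gamma> \<le> \<epsilon> * real t" by (simp add: \<epsilon>_def T_def)
    have "K * 16 \<le> K * (2 ^ 160 * R ^ 12)"
      using R1[of 12] by (intro mult_left_mono) (simp_all add: K_def)
    then show "\<gamma> \<le> real k / 8" using R0[of 12] by (simp add: \<gamma>_def K_def divide_le_eq)
    have "R * (4 * (2 ^ 50 * R ^ 4)) = 2 ^ 52 * R ^ 5" by (simp add: eval_nat_numeral)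
    also have "\<dots> \<le> T" by (rule T_le) auto
    also have "T \<le> K" using \<open>2 * T \<le> K\<close> T0 by linarith
    finally have "R \<le> \<epsilon> * R * (K / 4)"
      unfolding \<epsilon>R using R0[of 4] by (simp add: pos_le_divide_eq)
    then show "real r \<le> \<epsilon> * (real r * real k / 4)" by (simp add: R_def K_def)
    show "real r * (real t * (6 * real r * real S + ln (2 * real r))
      + (2 - ln \<epsilon>) * (72 * (real r)\<^sup>2 * real t / real S)) \<le> real r * real k / 4"
      unfolding R_def[symmetric] T_def[symmetric] K_def[symmetric]
    proof -
      have S0: "2 \<le> real S" unfolding S using R1[of 3] by simp
      have "ln (2 * R) \<le> R * 2" using ln_le_minus_one[of "2 * R"] R by simp
      also have "\<dots> \<le> R * real S" using S0 R by (intro mult_left_mono) auto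
      finally have "T * (6 * R * real S + ln (2 * R)) \<le> T * (7 * R * real S)"
        using T0 by (intro mult_left_mono) auto
      moreover have "(2 - ln \<epsilon>) * (72 * R\<^sup>2 * T / real S) \<le> T * (R * real S)"
      proof -
        have "72 * (2 - ln \<epsilon>) * R\<^sup>2 \<le> 72 * (62 * R) * R\<^sup>2"
          using L qR by (intro mult_right_mono mult_left_mono) auto
        also have "\<dots> = 4464 * R ^ 3" by (simp add: power2_eq_square power3_eq_cube)
        also have "\<dots> \<le> 2 ^ 60 * R ^ 7" using Rp[of 3 7] R0[of 3] by (intro mult_mono) auto
        also have "\<dots> = R * (real S)\<^sup>2" unfolding S2 by (simp add: eval_nat_numeral)
        finally have "T * (72 * (2 - ln \<epsilon>) * R\<^sup>2) \<le> T * (R * (real S)\<^sup>2)"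
          using T0 by (intro mult_left_mono) auto
        then show ?thesis using S0 by (simp add: divide_le_eq power2_eq_square mult_ac)
      qed
      ultimately have "R * (T * (6 * R * real S + ln (2 * R)) + (2 - ln \<epsilon>) * (72 * R\<^sup>2 * T / real S))
        \<le> R * (T * (8 * R * real S))"
        using R by (intro mult_left_mono) (auto simp: algebra_simps)
      also have "\<dots> = R * (2 ^ 33 * R ^ 4 * T)" unfolding S by (simp add: eval_nat_numeral)
      also have "\<dots> \<le> R * (K / 4)"
      proof -
        have "0 \<le> R ^ 4 * T" "2 ^ 36 * (R ^ 4 * T) \<le> K"
          using TK T0 R0[of 4] by (simp_all add: mult_ac)
        then have "2 ^ 33 * R ^ 4 * T \<le> K / 4" by simp
        then show ?thesis using R by (intro mult_left_mono) auto
      qed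
      finally show "R * (T * (6 * R * real S + ln (2 * R)) + (2 - ln \<epsilon>) * (72 * R\<^sup>2 * T / real S))
        \<le> R * K / 4" by simp
    qed
    show "4 * \<epsilon> * real r * real t
      + (2 - ln \<epsilon>) * (6 * real r * real t / (real S)\<^sup>2) * (ln (real r) + 4 * \<epsilon> * real r) + \<gamma>
      \<le> (real t)\<^sup>2 / (32 * real k)"
      unfolding R_def[symmetric] T_def[symmetric] K_def[symmetric]
    proof -
      \<comment> \<open>The common unit: the gain is at least \<open>G / 2^42\<close>, the losses
        are at most \<open>G / 2^48\<close>, \<open>1116 * G / 2^60\<close> and
        \<open>G / 2^60\<close>.\<close>
      define G where "G = T / R ^ 4"
      have G0: "0 \<le> G" using T0 R0[of 4] by (simp add: G_def)
      have "4 * \<epsilon> * R * T = 4 * (\<epsilon> * R) * T" by simp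
      also have "\<dots> = G / 2 ^ 48" unfolding \<epsilon>R by (simp add: G_def)
      finally have 1: "4 * \<epsilon> * R * T = G / 2 ^ 48" .
      have "ln R \<le> 2 * q" unfolding q_def using R by (intro ln_le_two_sqrt) simp
      then have "ln R + 4 * \<epsilon> * R \<le> 3 * q" "0 \<le> ln R + 4 * \<epsilon> * R"
        using \<open>4 * (\<epsilon> * R) \<le> 1\<close> q(2) R \<epsilon>0 by auto
      then have "(2 - ln \<epsilon>) * (6 * R * T / (real S)\<^sup>2) * (ln R + 4 * \<epsilon> * R)
          \<le> (62 * q) * (6 * R * T / (real S)\<^sup>2) * (3 * q)"
        using L R T0 q(2) by (intro mult_mono mult_nonneg_nonneg) auto
      also have "\<dots> = 1116 * R * R * T / (2 ^ 60 * R ^ 6)"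
        unfolding S2 using q(1) by (simp add: mult_ac)
      also have "\<dots> = 1116 * G / 2 ^ 60"
        using R by (simp add: G_def field_simps eval_nat_numeral)
      finally have 2: "(2 - ln \<epsilon>) * (6 * R * T / (real S)\<^sup>2) * (ln R + 4 * \<epsilon> * R) \<le> 1116 * G / 2 ^ 60" .
      have "T * (1 / (2 ^ 122 * R ^ 8)) \<le> T * (1 / (2 ^ 60 * R ^ 4))"
        using T0 Rp[of 4 8] R0[of 4] R0[of 8]
        by (intro mult_left_mono divide_left_mono mult_mono mult_pos_pos) auto
      then have 3: "\<gamma> \<le> G / 2 ^ 60" using \<gamma>_le by (simp add: G_def)
      have "G / 2 ^ 42 = T\<^sup>2 / (32 * (2 ^ 37 * R ^ 4 * T))"
        using T0 by (simp add: G_def power2_eq_square)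
      also have "\<dots> \<le> T\<^sup>2 / (32 * K)"
        using KT \<open>2 * T \<le> K\<close> T0 R0[of 4] by (intro divide_left_mono mult_left_mono mult_pos_pos) auto
      finally have 4: "G / 2 ^ 42 \<le> T\<^sup>2 / (32 * K)" .
      have "G / 2 ^ 48 + 1116 * G / 2 ^ 60 + G / 2 ^ 60 \<le> G / 2 ^ 42" using G0 by simp
      then show "4 * \<epsilon> * R * T + (2 - ln \<epsilon>) * (6 * R * T / (real S)\<^sup>2) * (ln R + 4 * \<epsilon> * R) + \<gamma>
        \<le> T\<^sup>2 / (32 * K)" using 1 2 3 4 by linarith
    qed
    show "real r * real k * ln (real r) - \<gamma> \<le> ln (real (card V))"
      using cV by (simp add: \<gamma>_def R_def K_def)
  qed
qed

theorem theorem5p1: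
  fixes r k :: nat and \<delta> :: real
  assumes "r \<ge> 2"
    and "\<delta> = 2 powi (-160) * real r powi (-12)"
    and "k \<ge> 2 ^ 160 * r ^ 16"
  shows "real (ramsey_number r k) \<le> exp (- \<delta> * real k) * real r ^ (r * k)"
proof -
  define B where "B = exp (- \<delta> * real k) * real r ^ (r * k)"
  define n where "n = nat \<lfloor>B\<rfloor>"
  have r: "2 \<le> real r" using assms(1) by simp
  have \<delta>: "\<delta> = 1 / (2 ^ 160 * real r ^ 12)"
    unfolding assms(2) power_int_minus power_int_numeral
    by (simp only: inverse_eq_divide times_divide_times_eq mult_1_left)
  have k: "2 ^ 160 * real r ^ 16 \<le> real k"
    using of_nat_mono[OF assms(3), where 'a=real] by simp
  have \<delta>k: "1 \<le> \<delta> * real k"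
  proof -
    have "2 ^ 160 * real r ^ 12 \<le> 2 ^ 160 * real r ^ 16"
      using r by (intro mult_left_mono power_increasing) auto
    also note k
    finally show ?thesis using r by (simp add: \<delta> le_divide_eq)
  qed
  have B_eq: "B = exp (real r * real k * ln (real r) - \<delta> * real k)"
  proof -
    have "real r ^ (r * k) = exp (real (r * k) * ln (real r))"
      using exp_of_nat_mult[of "r * k" "ln (real r)"] r by simp
    then show ?thesis by (simp add: B_def flip: exp_add)
  qed
  \<comment> \<open>As \<open>2 <= B\<close>, rounding \<open>B\<close> down keeps at least half of
    it, and \<open>1 <= \<delta> * k\<close> lets a second factor
    \<open>exp (- \<delta> * k)\<close> pay for this half.\<close>
  have "exp (real r * real k * ln (real r) - 2 * \<delta> * real k) \<le> B / 2"
  proof -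
    have "exp (- (\<delta> * real k)) \<le> exp (- 1)" using \<delta>k by simp
    also have "\<dots> \<le> 1 / (2 :: real)"
      using exp_ge_add_one_self[of "1::real"] by (simp add: exp_minus field_simps)
    finally have "B * exp (- (\<delta> * real k)) \<le> B * (1 / 2)"
      by (intro mult_left_mono) (simp_all add: B_eq)
    then show ?thesis by (simp add: B_eq algebra_simps flip: exp_add)
  qed
  moreover have "2 \<le> B"
  proof -
    have p: "1 \<le> real r ^ n" for n using r by (intro one_le_power) simp
    have "2 \<le> 2 ^ 160 * real r ^ 12" using p[of 12] by simp
    then have "\<delta> \<le> 1 / 2" using r by (simp add: \<delta> divide_le_eq)
    then have "\<delta> * real k \<le> 1 / 2 * real k" by (intro mult_right_mono) auto
    moreover have "2 * real k * (1 / 2) \<le> real r * real k * ln (real r)"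
    proof -
      have "ln 2 \<le> ln (real r)" using r by simp
      then have "1 / 2 \<le> ln (real r)" using half_le_ln_2 by linarith
      then show ?thesis using r by (intro mult_mono) auto
    qed
    moreover have "2 \<le> 2 ^ 160 * real r ^ 16" using p[of 16] by simp
    then have "2 \<le> real k" using k by (rule order_trans)
    ultimately have "1 \<le> real r * real k * ln (real r) - \<delta> * real k" by linarith
    then show ?thesis
      using exp_ge_add_one_self[of "real r * real k * ln (real r) - \<delta> * real k"]
      unfolding B_eq by linarith
  qed
  ultimately have n_ge: "exp (real r * real k * ln (real r) - 2 * \<delta> * real k) \<le> real n"
    unfolding n_def by linarith
  have "partn {..<n} k 2 {..<r}"
    unfolding partn_def
  proof
    fix f :: "nat set \<Rightarrow> nat" assume f: "f \<in> nsets {..<n} 2 \<rightarrow> {..<r}"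
    interpret edge_coloring f "{..<n}" r
    proof
      fix x y :: nat assume "x \<in> {..<n}" "y \<in> {..<n}" "x \<noteq> y"
      then have "{x, y} \<in> nsets {..<n} 2" by (auto simp: nsets_def)
      then show "f {x, y} < r" using f by auto
    qed simp
    have n0: "0 < real n" using n_ge by (meson exp_gt_zero less_le_trans)
    have "real r * real k * ln (real r) - 2 * \<delta> * real k \<le> ln (real n)"
      using n_ge n0 by (simp add: ln_ge_iff)
    then have "has_clique {..<n} (\<lambda>_. k)"
      using n0 assms by (intro has_clique_diagonal) (auto simp: \<delta>)
    then obtain i H where H: "i < r" "H \<subseteq> {..<n}" "card H = k" "clique i H"
      by (auto simp: has_clique_def)
    have "f ` nsets H 2 \<subseteq> {i}"
      using H(4) by (auto simp: clique_def nsets_def card_2_iff)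
    then have "monochromatic {..<n} k 2 f i"
      unfolding monochromatic_def
      using H finite_subset[OF H(2)] by (intro bexI[of _ H]) (auto simp: nsets_def)
    then show "\<exists>\<xi>\<in>{..<r}. monochromatic {..<n} k 2 f \<xi>" using H(1) by blast
  qed
  then have "ramsey_number r k \<le> n" unfolding ramsey_number_def by (rule Least_le)
  also have "real n \<le> B" unfolding n_def using \<open>2 \<le> B\<close> by simp
  finally show ?thesis by (simp add: B_def)
qed

end
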